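(* Let $\mathcal{H}$ be a complex separable Hilbert space and let $T \in \mathcal{B}(\mathcal{H})$ be normal. The following are equivalent: (a) there exists a unitary $U \in \mathcal{B}(\mathcal{H})$ with $-T = U^* T U$; (b) $T$ is similar to $-T$; (c) $T = MN - NM$ for some $M, N \in \mathcal{B}(\mathcal{H})$ with $M^2 = 0 = N^2$. *)

theory Defs
  imports "HOL-Analysis.Analysis"
begin

class complex_vector = real_vector +
  fixes scaleC :: "complex \<Rightarrow> 'a \<Rightarrow> 'a"
  assumes scaleC_add_right: "scaleC a (x + y) = scaleC a x + scaleC a y"
    and scaleC_add_left: "scaleC (a + b) x = scaleC a x + scaleC b x"
    and scaleC_scaleC: "scaleC a (scaleC b x) = scaleC (a * b) x"
    and scaleC_one: "scaleC 1 x = x"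
    and scaleR_scaleC: "scaleR r x = scaleC (complex_of_real r) x"

class complex_inner = complex_vector + real_normed_vector +
  fixes cinner :: "'a \<Rightarrow> 'a \<Rightarrow> complex"
  assumes cinner_commute: "cinner x y = cnj (cinner y x)"
    and cinner_add_left: "cinner (x + y) z = cinner x z + cinner y z"
    and cinner_scaleC_left: "cinner (scaleC r x) y = cnj r * cinner x y"
    and cinner_real: "Im (cinner x x) = 0"
    and cinner_ge_zero: "0 \<le> Re (cinner x x)"
    and cinner_eq_zero_iff: "cinner x x = 0 \<longleftrightarrow> x = 0"
    and norm_eq_sqrt_cinner: "norm x = sqrt (Re (cinner x x))"

class chilbert_space = complex_inner + complete_space

definition bounded_clinear_op :: "('a::complex_inner \<Rightarrow> 'a) \<Rightarrow> bool" where
  "bounded_clinear_op T \<longleftrightarrow>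
     (\<forall>x y. T (x + y) = T x + T y) \<and>
     (\<forall>c x. T (scaleC c x) = scaleC c (T x)) \<and>
     (\<exists>K. \<forall>x. norm (T x) \<le> norm x * K)"

definition cadjoint :: "('a::complex_inner \<Rightarrow> 'a) \<Rightarrow> ('a \<Rightarrow> 'a)" where
  "cadjoint T = (SOME S. \<forall>x y. cinner (T x) y = cinner x (S y))"

definition unitary_op :: "('a::complex_inner \<Rightarrow> 'a) \<Rightarrow> bool" where
  "unitary_op U \<longleftrightarrow> bounded_clinear_op U \<and> cadjoint U \<circ> U = id \<and> U \<circ> cadjoint U = id"

definition normal_op :: "('a::complex_inner \<Rightarrow> 'a) \<Rightarrow> bool" where
  "normal_op T \<longleftrightarrow> bounded_clinear_op T \<and> cadjoint T \<circ> T = T \<circ> cadjoint T"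

definition similar_op :: "('a::complex_inner \<Rightarrow> 'a) \<Rightarrow> ('a \<Rightarrow> 'a) \<Rightarrow> bool" where
  "similar_op A B \<longleftrightarrow> (\<exists>S Sinv. bounded_clinear_op S \<and> bounded_clinear_op Sinv \<and>
      S \<circ> Sinv = id \<and> Sinv \<circ> S = id \<and> B = Sinv \<circ> A \<circ> S)"

end

theory Submission
  imports Defs "HOL-Complex_Analysis.Cauchy_Integral_Formula"
begin

text \<open>
  If \<open>T\<close> is normal and \<open>T X = - X T\<close> for some \<open>X\<close> such that \<open>X\<close> and \<open>X*\<close> are injective, then
  \<open>X\<close> also anticommutes with \<open>T*\<close> by the Fuglede--Putnam theorem, and so does the unitary factor in
  the polar decomposition of \<open>X\<close>. This gives (b) \<open>\<Longrightarrow>\<close> (a). For (c) \<open>\<Longrightarrow>\<close> (a), both \<open>M\<close> and \<open>N\<close>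
  anticommute with \<open>T\<close>, and \<open>(M + N)\<^sup>4 = T\<^sup>2\<close>; hence \<open>M + N\<close> is injective with dense range on
  \<open>(ker T)\<^sup>\<bottom>\<close>. For (a) \<open>\<Longrightarrow>\<close> (c), let \<open>E\<close> and \<open>F\<close> be the spectral projections of \<open>T\<close> for two
  sets that are interchanged by \<open>z \<mapsto> - z\<close> and partition the punctured plane. Then \<open>U E = F U\<close>, and
  \<open>M = T E U*\<close>, \<open>N = U E\<close> solve the problem. These projections are polynomials in the signs of the
  real and imaginary parts of \<open>T\<close>, so the strong limit of the Newton--Schulz iteration for the polar
  factor replaces the spectral theorem throughout.
\<close>

section \<open>Inner products and adjoints\<close>

lemma cinner_add_right: "cinner x (y + z) = cinner x y + cinner (x::'a::complex_inner) z"
  by (metis cinner_add_left cinner_commute complex_cnj_add)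

lemma cinner_scaleC_right: "cinner x (scaleC c y) = c * cinner (x::'a::complex_inner) y"
  by (metis cinner_commute cinner_scaleC_left complex_cnj_cnj complex_cnj_mult)

lemma scaleC_minus1: "scaleC (-1) x = - (x::'a::complex_vector)"
  by (metis of_real_1 of_real_minus scaleR_minus1_left scaleR_scaleC)

lemma cinner_minus_left [simp]: "cinner (- x) y = - cinner (x::'a::complex_inner) y"
  by (metis cinner_scaleC_left scaleC_minus1 complex_cnj_minus complex_cnj_one mult_minus1)

lemma cinner_minus_right [simp]: "cinner x (- y) = - cinner (x::'a::complex_inner) y"
  by (metis cinner_scaleC_right scaleC_minus1 mult_minus1)

lemma cinner_diff_left: "cinner (x - y) z = cinner x z - cinner (y::'a::complex_inner) z"
  by (metis cinner_add_left cinner_minus_left diff_conv_add_uminus)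

lemma cinner_diff_right: "cinner x (y - z) = cinner x y - cinner (x::'a::complex_inner) z"
  by (metis cinner_add_right cinner_minus_right diff_conv_add_uminus)

lemma cinner_zero_left [simp]: "cinner 0 (y::'a::complex_inner) = 0"
  using cinner_diff_left[of y y y] by simp

lemma cinner_zero_right [simp]: "cinner (y::'a::complex_inner) 0 = 0"
  using cinner_diff_right[of y y y] by simp

lemma cinner_scaleR_left: "cinner (r *\<^sub>R x) y = of_real r * cinner (x::'a::complex_inner) y"
  by (simp add: scaleR_scaleC cinner_scaleC_left)

lemma cinner_scaleR_right: "cinner x (r *\<^sub>R y) = of_real r * cinner (x::'a::complex_inner) y"
  by (simp add: scaleR_scaleC cinner_scaleC_right)

lemmas cinner_simps = cinner_add_left cinner_add_right cinner_diff_left cinner_diff_right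
  cinner_scaleR_left cinner_scaleR_right cinner_scaleC_left cinner_scaleC_right

lemma Re_cinner_commute: "Re (cinner x y) = Re (cinner y (x::'a::complex_inner))"
  by (subst cinner_commute) simp

lemma norm_sq_cinner: "(norm (x::'a::complex_inner))\<^sup>2 = Re (cinner x x)"
  by (simp add: norm_eq_sqrt_cinner cinner_ge_zero)

lemma cinner_self: "cinner x x = of_real ((norm (x::'a::complex_inner))\<^sup>2)"
  by (simp add: complex_eq_iff norm_sq_cinner cinner_real)

lemma norm_add_sq:
  "(norm (x + y))\<^sup>2 = (norm x)\<^sup>2 + 2 * Re (cinner x y) + (norm (y::'a::complex_inner))\<^sup>2"
  using Re_cinner_commute[of x y] by (simp add: norm_sq_cinner cinner_simps)

lemma norm_diff_sq:
  "(norm (x - y))\<^sup>2 = (norm x)\<^sup>2 - 2 * Re (cinner x y) + (norm (y::'a::complex_inner))\<^sup>2"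
  using Re_cinner_commute[of x y] by (simp add: norm_sq_cinner cinner_simps)

lemma norm_scaleC: "norm (scaleC c x) = cmod c * norm (x::'a::complex_inner)"
proof -
  have "(norm (scaleC c x))\<^sup>2 = Re (cnj c * c * cinner x x)"
    by (simp add: norm_sq_cinner cinner_simps algebra_simps)
  also have "cnj c * c * cinner x x = of_real ((cmod c * norm x)\<^sup>2)"
    by (simp add: cinner_self power_mult_distrib complex_norm_square[symmetric] mult.commute[of "cnj c"]
        flip: of_real_power)
  finally show ?thesis
    by (simp add: power2_eq_iff_nonneg)
qed

text \<open>Squaring the triangle inequality, which comes with the norm class, isolates the real
  part of the mixed term.\<close>

lemma Re_cinner_le: "Re (cinner x y) \<le> norm x * norm (y::'a::complex_inner)"
proof -
  have "(norm (x + y))\<^sup>2 \<le> (norm x + norm y)\<^sup>2"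
    by (simp add: norm_triangle_ineq power_mono)
  then show ?thesis
    by (simp add: norm_add_sq power2_sum)
qed

lemma cinner_Cauchy_Schwarz: "cmod (cinner x y) \<le> norm x * norm (y::'a::complex_inner)"
proof (cases "cinner x y = 0")
  case False
  \<comment> \<open>Rotating \<open>y\<close> by this phase makes the inner product real and
    nonnegative, so the bound on real parts applies.\<close>
  define c where "c = cnj (sgn (cinner x y))"
  have "cmod c = 1"
    using False by (simp add: c_def norm_sgn)
  have "c * cinner x y = of_real (cmod (cinner x y))"
    using False
    by (simp add: c_def sgn_eq complex_norm_square[symmetric] mult.commute power2_eq_square)
  then have "cmod (cinner x y) = Re (cinner x (scaleC c y))"
    by (simp add: cinner_simps)
  also have "\<dots> \<le> norm x * norm (scaleC c y)"
    by (rule Re_cinner_le)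
  finally show ?thesis
    using \<open>cmod c = 1\<close> by (simp add: norm_scaleC)
qed simp

lemma cinner_ext_right: "(\<And>x. cinner x y = cinner x z) \<Longrightarrow> y = (z::'a::complex_inner)"
  using cinner_eq_zero_iff[of "y - z"] by (simp add: cinner_simps)

lemma bounded_bilinear_cinner:
  "bounded_bilinear (cinner :: 'a::complex_inner \<Rightarrow> 'a \<Rightarrow> complex)"
  by unfold_locales
    (auto simp: cinner_simps scaleR_conv_of_real intro!: exI[of _ 1] cinner_Cauchy_Schwarz)

lemmas tendsto_cinner = bounded_bilinear.tendsto[OF bounded_bilinear_cinner]

text \<open>The representing vector minimises \<open>\<parallel>x\<parallel>\<^sup>2 - 2 Re (\<phi> x)\<close>; the parallelogram law makes
  minimising sequences Cauchy.\<close>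

lemma riesz_representation:
  fixes \<phi> :: "'a::chilbert_space \<Rightarrow> complex"
  assumes add: "\<And>x y. \<phi> (x + y) = \<phi> x + \<phi> y"
    and scale: "\<And>c x. \<phi> (scaleC c x) = c * \<phi> x"
    and bound: "\<And>x. cmod (\<phi> x) \<le> norm x * K"
  shows "\<exists>z. \<forall>x. \<phi> x = cinner z x"
proof -
  define F where "F x = (norm x)\<^sup>2 - 2 * Re (\<phi> x)" for x
  have scaleR: "\<phi> (r *\<^sub>R x) = of_real r * \<phi> x" for r x
    by (simp add: scaleR_scaleC scale)
  have diff: "\<phi> (x - y) = \<phi> x - \<phi> y" for x y
    using add[of "x - y" y] by simp
  have lower: "- K\<^sup>2 \<le> F x" for x
  proof -
    have "Re (\<phi> x) \<le> norm x * K"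
      using bound[of x] complex_Re_le_cmod[of "\<phi> x"] by linarith
    moreover have "0 \<le> (norm x - K)\<^sup>2"
      by simp
    ultimately show ?thesis
      by (simp add: F_def power2_diff)
  qed
  define m where "m = (INF x. F x)"
  have bdd: "bdd_below (range F)"
    using lower by (auto intro!: bdd_belowI2)
  have m_le: "m \<le> F x" for x
    unfolding m_def by (rule cINF_lower[OF bdd]) simp
  have "\<exists>x. F x < m + inverse (real (Suc n))" for n
    using cINF_less_iff[OF _ bdd, of "m + inverse (real (Suc n))"]
    by (auto simp: m_def[symmetric])
  then obtain u where u: "\<And>n. F (u n) < m + inverse (real (Suc n))"
    by metis
  \<comment> \<open>The linear part of \<open>F\<close> cancels and the parallelogram identity
    remains.\<close>
  have para: "(norm (x - y))\<^sup>2 = 2 * F x + 2 * F y - 4 * F ((1/2) *\<^sub>R (x + y))" for x y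
  proof -
    have "4 * F ((1/2) *\<^sub>R (x + y)) = (norm (x + y))\<^sup>2 - 4 * Re (\<phi> x) - 4 * Re (\<phi> y)"
      by (simp add: F_def scaleR add power_divide algebra_simps del: scaleR_add_right)
    then show ?thesis
      by (simp add: F_def norm_diff_sq norm_add_sq)
  qed
  have close: "(norm (x - y))\<^sup>2 \<le> 2 * (F x - m) + 2 * (F y - m)" for x y
    using para[of x y] m_le[of "(1/2) *\<^sub>R (x + y)"] by simp
  have "Cauchy u"
  proof (rule metric_CauchyI)
    fix e :: real assume "0 < e"
    \<comment> \<open>A quarter, because \<open>close\<close> adds twice the excess over
      \<open>m\<close> of each of the two points.\<close>
    then obtain N where N: "inverse (real (Suc N)) < e\<^sup>2 / 4"
      using reals_Archimedean[of "e\<^sup>2 / 4"] by auto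
    have "dist (u k) (u l) < e" if "N \<le> k" "N \<le> l" for k l
    proof -
      have "F (u j) - m < e\<^sup>2 / 4" if "N \<le> j" for j
      proof -
        have "F (u j) < m + inverse (real (Suc j))"
          by (rule u)
        also have "\<dots> \<le> m + inverse (real (Suc N))"
          using that by simp
        also have "\<dots> < m + e\<^sup>2 / 4"
          using N by simp
        finally show ?thesis by simp
      qed
      from this[OF that(1)] this[OF that(2)]
      have "(norm (u k - u l))\<^sup>2 < e\<^sup>2"
        using close[of "u k" "u l"] by (simp add: field_simps)
      then show ?thesis
        using \<open>0 < e\<close> by (simp add: dist_norm power_less_imp_less_base)
    qed
    then show "\<exists>M. \<forall>k\<ge>M. \<forall>l\<ge>M. dist (u k) (u l) < e"
      by blast
  qed
  then obtain z where z: "u \<longlonglongrightarrow> z"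
    using Cauchy_convergent_iff convergent_def by blast
  have "bounded_linear \<phi>"
    using bound by (intro bounded_linear_intro[of _ K])
      (simp_all add: add scaleR scaleR_conv_of_real)
  then have \<phi>z: "(\<lambda>n. \<phi> (u n)) \<longlonglongrightarrow> \<phi> z"
    using bounded_linear.tendsto z by blast
  have Fz: "(\<lambda>n. F (u n)) \<longlonglongrightarrow> F z"
    unfolding F_def by (intro tendsto_intros z \<phi>z)
  have "(\<lambda>n. m + inverse (real (Suc n))) \<longlonglongrightarrow> m + 0"
    by (intro tendsto_intros LIMSEQ_inverse_real_of_nat)
  then have "F z \<le> m"
    using LIMSEQ_le[OF Fz] u by (force intro: less_imp_le)
  then have min: "F z \<le> F x" for x
    using m_le[of x] by linarith
  have Re_eq: "Re (\<phi> h) = Re (cinner z h)" for h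
  proof -
    define b where "b = Re (cinner z h) - Re (\<phi> h)"
    \<comment> \<open>Minimality of \<open>z\<close> along the line \<open>z + t h\<close>; the
      first variation \<open>b\<close> must therefore vanish.\<close>
    have ineq: "0 \<le> 2 * t * b + t\<^sup>2 * (norm h)\<^sup>2" for t
      using min[of "z + t *\<^sub>R h"]
      by (simp add: F_def b_def norm_add_sq cinner_simps add scaleR power_mult_distrib
          algebra_simps)
    have "b = 0"
    proof (rule ccontr)
      assume "b \<noteq> 0"
      \<comment> \<open>The summand 1 keeps the divisor positive even for \<open>h = 0\<close>;
        taking \<open>t = - b / s\<close> then contradicts \<open>ineq\<close>.\<close>
      define s where "s = 1 + (norm h)\<^sup>2"
      have "s > 0" by (simp add: s_def add_pos_nonneg)
      have "0 \<le> 2 * (- b / s) * b + (b / s)\<^sup>2 * (norm h)\<^sup>2"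
        using ineq[of "- b / s"] by simp
      also have "\<dots> \<le> 2 * (- b / s) * b + (b / s)\<^sup>2 * s"
        by (intro add_left_mono mult_left_mono) (simp_all add: s_def)
      also have "\<dots> = - (b\<^sup>2 / s)"
        using \<open>s > 0\<close> by (simp add: field_simps power2_eq_square)
      also have "\<dots> < 0"
        using \<open>s > 0\<close> \<open>b \<noteq> 0\<close> by simp
      finally show False by simp
    qed
    then show ?thesis by (simp add: b_def)
  qed
  \<comment> \<open>Multiplication by \<open>-\<i>\<close> turns the imaginary part into a real
    part.\<close>
  have "\<phi> x = cinner z x" for x
    using Re_eq[of x] Re_eq[of "scaleC (-\<i>) x"]
    by (simp add: complex_eq_iff scale cinner_simps)
  then show ?thesis by blast
qed

section \<open>Existence and boundedness of adjoints\<close>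

lemma bounded_clinear_opD:
  assumes "bounded_clinear_op T"
  shows "T (x + y) = T x + T y" "T (scaleC c x) = scaleC c (T x)"
    "\<exists>K. \<forall>x. norm (T x) \<le> norm x * K"
  using assms by (auto simp: bounded_clinear_op_def)

text \<open>Riesz representation of \<open>x \<mapsto> cinner y (T x)\<close> supplies a witness for
  the choice that defines \<open>cadjoint\<close>.\<close>

lemma cinner_cadjoint:
  fixes T :: "'a::chilbert_space \<Rightarrow> 'a"
  assumes T: "bounded_clinear_op T"
  shows "cinner (T x) y = cinner x (cadjoint T y)"
proof -
  obtain K where K: "\<And>x. norm (T x) \<le> norm x * K"
    using bounded_clinear_opD(3)[OF T] by blast
  have "\<exists>z. \<forall>x. cinner (T x) y = cinner x z" for y
  proof -
    have "\<exists>z. \<forall>x. cinner y (T x) = cinner z x"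
    proof (rule riesz_representation)
      fix x
      have "cmod (cinner y (T x)) \<le> norm y * norm (T x)"
        by (rule cinner_Cauchy_Schwarz)
      also have "\<dots> \<le> norm x * (norm y * K)"
        using mult_left_mono[OF K[of x], of "norm y"] by (simp add: ac_simps)
      finally show "cmod (cinner y (T x)) \<le> norm x * (norm y * K)" .
    qed (simp_all add: bounded_clinear_opD[OF T] cinner_simps)
    then show ?thesis
      by (metis cinner_commute)
  qed
  then have "\<exists>S. \<forall>x y. cinner (T x) y = cinner x (S y)"
    by metis
  then have "\<forall>x y. cinner (T x) y = cinner x (cadjoint T y)"
    unfolding cadjoint_def by (rule someI_ex)
  then show ?thesis by blast
qed

lemma bounded_clinear_op_cadjoint:
  fixes T :: "'a::chilbert_space \<Rightarrow> 'a"
  assumes T: "bounded_clinear_op T"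
  shows "bounded_clinear_op (cadjoint T)"
proof -
  note adj = cinner_cadjoint[OF T, symmetric]
  obtain K where K: "\<And>x. norm (T x) \<le> norm x * K"
    using bounded_clinear_opD(3)[OF T] by blast
  \<comment> \<open>The absolute value makes the factor nonnegative, since the sign of
    \<open>K\<close> is not fixed.\<close>
  have "norm (cadjoint T y) \<le> norm y * \<bar>K\<bar>" for y
  proof (cases "cadjoint T y = 0")
    case False
    define z where "z = cadjoint T y"
    have "(norm z)\<^sup>2 = Re (cinner (T z) y)"
      by (simp add: norm_sq_cinner z_def adj)
    also have "\<dots> \<le> norm (T z) * norm y"
      by (rule Re_cinner_le)
    also have "\<dots> \<le> norm z * \<bar>K\<bar> * norm y"
      using K[of z] mult_left_mono[OF abs_ge_self[of K] norm_ge_zero[of z]]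
      by (intro mult_right_mono) auto
    finally show ?thesis
      using False by (simp add: z_def power2_eq_square mult.assoc mult.commute[of "norm y"])
  qed simp
  moreover have "cadjoint T (x + y) = cadjoint T x + cadjoint T y" for x y
    by (rule cinner_ext_right) (simp add: adj cinner_simps)
  moreover have "cadjoint T (scaleC c x) = scaleC c (cadjoint T x)" for c x
    by (rule cinner_ext_right) (simp add: adj cinner_simps)
  ultimately show ?thesis
    unfolding bounded_clinear_op_def by blast
qed

section \<open>The algebra of bounded operators\<close>

lemma scaleC_zero_right [simp]: "scaleC c (0::'a::complex_vector) = 0"
  using scaleC_add_right[of c "0::'a" 0] by simp

lemma scaleC_zero_left [simp]: "scaleC 0 (x::'a::complex_vector) = 0"
  using scaleR_scaleC[of 0 x] by simp

lemma scaleC_minus_right: "scaleC c (- x) = - scaleC c (x::'a::complex_vector)"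
  using scaleC_add_right[of c x "- x"] by (simp add: eq_neg_iff_add_eq_0 add.commute)

lemma scaleC_diff_right: "scaleC c (x - y) = scaleC c x - scaleC c (y::'a::complex_vector)"
  using scaleC_add_right[of c x "- y"] by (simp add: scaleC_minus_right)

lemma scaleC_scaleR: "scaleC c (r *\<^sub>R x) = r *\<^sub>R scaleC c (x::'a::complex_vector)"
  by (simp add: scaleR_scaleC scaleC_scaleC mult.commute)

lemma bounded_clinear_opI:
  assumes "\<And>x y. T (x + y) = T x + T y" "\<And>c x. T (scaleC c x) = scaleC c (T x)"
    and "\<And>x. norm (T x) \<le> norm x * K"
  shows "bounded_clinear_op T"
  using assms unfolding bounded_clinear_op_def by blast

text \<open>A type of its own turns operator identities into ring identities. It carries no norm:
  estimates and limits are taken vector by vector.\<close>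

typedef (overloaded) 'a bop = "{T :: 'a::chilbert_space \<Rightarrow> 'a. bounded_clinear_op T}"
  morphisms app Bop
  by (rule exI[of _ "\<lambda>_. 0"]) (auto intro: bounded_clinear_opI[where K = 0])

setup_lifting type_definition_bop

instantiation bop :: (chilbert_space) "{ring, monoid_mult, real_vector}"
begin

lift_definition zero_bop :: "'a bop" is "\<lambda>_. 0"
  by (rule bounded_clinear_opI[where K = 0]) simp_all

lift_definition one_bop :: "'a bop" is "\<lambda>x. x"
  by (rule bounded_clinear_opI[where K = 1]) simp_all

lift_definition uminus_bop :: "'a bop \<Rightarrow> 'a bop" is "\<lambda>T x. - T x"
  by (auto simp: bounded_clinear_op_def scaleC_minus_right)

lift_definition plus_bop :: "'a bop \<Rightarrow> 'a bop \<Rightarrow> 'a bop" is "\<lambda>S T x. S x + T x"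
proof -
  fix S T :: "'a \<Rightarrow> 'a"
  assume S: "bounded_clinear_op S" and T: "bounded_clinear_op T"
  obtain K L where "\<And>x. norm (S x) \<le> norm x * K" "\<And>x. norm (T x) \<le> norm x * L"
    using bounded_clinear_opD(3)[OF S] bounded_clinear_opD(3)[OF T] by blast
  then have "norm (S x + T x) \<le> norm x * (K + L)" for x
    by (simp add: distrib_left norm_triangle_mono)
  then show "bounded_clinear_op (\<lambda>x. S x + T x)"
    by (rule bounded_clinear_opI[rotated 2])
      (simp_all add: bounded_clinear_opD[OF S] bounded_clinear_opD[OF T] scaleC_add_right)
qed

lift_definition minus_bop :: "'a bop \<Rightarrow> 'a bop \<Rightarrow> 'a bop" is "\<lambda>S T x. S x - T x"
proof -
  fix S T :: "'a \<Rightarrow> 'a"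
  assume S: "bounded_clinear_op S" and T: "bounded_clinear_op T"
  obtain K L where KL: "\<And>x. norm (S x) \<le> norm x * K" "\<And>x. norm (T x) \<le> norm x * L"
    using bounded_clinear_opD(3)[OF S] bounded_clinear_opD(3)[OF T] by blast
  have "norm (S x - T x) \<le> norm x * (K + L)" for x
    using norm_triangle_ineq4[of "S x" "T x"] KL[of x] by (simp add: distrib_left)
  then show "bounded_clinear_op (\<lambda>x. S x - T x)"
    by (rule bounded_clinear_opI[rotated 2])
      (simp_all add: bounded_clinear_opD[OF S] bounded_clinear_opD[OF T] scaleC_diff_right)
qed

lift_definition times_bop :: "'a bop \<Rightarrow> 'a bop \<Rightarrow> 'a bop" is "\<lambda>S T x. S (T x)"
proof -
  fix S T :: "'a \<Rightarrow> 'a"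
  assume S: "bounded_clinear_op S" and T: "bounded_clinear_op T"
  obtain K L where KL: "\<And>x. norm (S x) \<le> norm x * K" "\<And>x. norm (T x) \<le> norm x * L"
    using bounded_clinear_opD(3)[OF S] bounded_clinear_opD(3)[OF T] by blast
  have "norm (S (T x)) \<le> norm x * (\<bar>L\<bar> * \<bar>K\<bar>)" for x
  proof -
    have "norm (S (T x)) \<le> norm (T x) * \<bar>K\<bar>"
      using KL(1)[of "T x"] mult_left_mono[OF abs_ge_self[of K] norm_ge_zero[of "T x"]] by linarith
    also have "norm (T x) \<le> norm x * \<bar>L\<bar>"
      using KL(2)[of x] mult_left_mono[OF abs_ge_self[of L] norm_ge_zero[of x]] by linarith
    finally show ?thesis
      by (simp add: mult_right_mono mult.assoc)
  qed
  then show "bounded_clinear_op (\<lambda>x. S (T x))"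
    by (rule bounded_clinear_opI[rotated 2])
      (simp_all add: bounded_clinear_opD[OF S] bounded_clinear_opD[OF T])
qed

lift_definition scaleR_bop :: "real \<Rightarrow> 'a bop \<Rightarrow> 'a bop" is "\<lambda>r T x. r *\<^sub>R T x"
proof -
  fix r and T :: "'a \<Rightarrow> 'a"
  assume T: "bounded_clinear_op T"
  obtain K where "\<And>x. norm (T x) \<le> norm x * K"
    using bounded_clinear_opD(3)[OF T] by blast
  then have "norm (r *\<^sub>R T x) \<le> norm x * (\<bar>r\<bar> * K)" for x
    using mult_left_mono[of "norm (T x)" "norm x * K" "\<bar>r\<bar>"] by (simp add: ac_simps)
  then show "bounded_clinear_op (\<lambda>x. r *\<^sub>R T x)"
    by (rule bounded_clinear_opI[rotated 2])
      (simp_all add: bounded_clinear_opD[OF T] scaleR_add_right scaleC_scaleR)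
qed

instance
proof
  fix A B C :: "'a bop" and r s :: real
  show "A + B + C = A + (B + C)" "A + B = B + A" "0 + A = A" "- A + A = 0" "A - B = A + - B"
    "A * B * C = A * (B * C)" "(A + B) * C = A * C + B * C" "1 * A = A" "A * 1 = A"
    "r *\<^sub>R (A + B) = r *\<^sub>R A + r *\<^sub>R B" "(r + s) *\<^sub>R A = r *\<^sub>R A + s *\<^sub>R A"
    "r *\<^sub>R s *\<^sub>R A = (r * s) *\<^sub>R A" "1 *\<^sub>R A = A"
    by (transfer; simp add: fun_eq_iff scaleR_add_right scaleR_add_left)+
  show "A * (B + C) = A * B + A * C"
    by transfer (simp add: bounded_clinear_opD(1))
qed

end

section \<open>Adjoints and complex scalars in the operator algebra\<close>

lift_definition adj :: "'a::chilbert_space bop \<Rightarrow> 'a bop" is cadjoint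
  by (rule bounded_clinear_op_cadjoint)

text \<open>Complex scalars enter the real algebra as central elements.\<close>

lift_definition cscal :: "complex \<Rightarrow> 'a::chilbert_space bop" is scaleC
  by (rule_tac K = "cmod complex" in bounded_clinear_opI)
    (simp_all add: scaleC_add_right scaleC_scaleC norm_scaleC mult.commute)

lemma bop_eqI: "(\<And>x. app S x = app T x) \<Longrightarrow> S = T"
  by (simp add: app_inject[symmetric] fun_eq_iff)

lemma app_simps [simp]:
  "app 0 x = 0" "app 1 x = x" "app (- S) x = - app S x" "app (S + T) x = app S x + app T x"
  "app (S - T) x = app S x - app T x" "app (S * T) x = app S (app T x)"
  "app (r *\<^sub>R S) x = r *\<^sub>R app S x" "app (cscal c) x = scaleC c x"
  by (transfer; simp)+

lemma bounded_clinear_op_app: "bounded_clinear_op (app T)"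
  using app by blast

lemma app_add: "app T (x + y) = app T x + app T y"
  and app_scaleC: "app T (scaleC c x) = scaleC c (app T x)"
  by (simp_all add: bounded_clinear_opD[OF bounded_clinear_op_app])

lemma bounded_linear_app: "bounded_linear (app T)"
proof -
  obtain K where "\<And>x. norm (app T x) \<le> norm x * K"
    using bounded_clinear_opD(3)[OF bounded_clinear_op_app] by blast
  then show ?thesis
    by (intro bounded_linear_intro[of _ K]) (simp_all add: app_add app_scaleC scaleR_scaleC)
qed

lemma app_scaleR: "app T (r *\<^sub>R x) = r *\<^sub>R app T x"
  and app_diff: "app T (x - y) = app T x - app T y"
  and app_minus: "app T (- x) = - app T x"
  and app_zero [simp]: "app T 0 = 0"
  by (rule linear_cmul linear_diff linear_neg linear_0, rule bounded_linear.linear[OF bounded_linear_app])+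

instance bop :: (chilbert_space) real_algebra
  by standard (rule bop_eqI; simp add: app_scaleR)+

lemma cinner_adj_right: "cinner x (app (adj T) y) = cinner (app T x) y"
  by transfer (simp add: cinner_cadjoint)

lemma cinner_adj_left: "cinner (app (adj T) x) y = cinner x (app T y)"
  by (metis cinner_adj_right cinner_commute)

lemma adjI: "(\<And>x y. cinner (app S x) y = cinner x (app T y)) \<Longrightarrow> T = adj S"
  by (rule bop_eqI, rule cinner_ext_right) (simp add: cinner_adj_right)

lemma adj_adj [simp]: "adj (adj T) = T"
  by (rule adjI[symmetric]) (simp add: cinner_adj_left)

lemma adj_simps [simp]:
  "adj 0 = 0" "adj 1 = 1" "adj (- S) = - adj S" "adj (S + T) = adj S + adj T"
  "adj (S - T) = adj S - adj T" "adj (S * T) = adj T * adj S" "adj (r *\<^sub>R S) = r *\<^sub>R adj S"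
  "adj (cscal c) = cscal (cnj c)"
  by (rule adjI[symmetric]; simp add: cinner_simps cinner_adj_left cinner_adj_right)+

lemma cscal_mult: "cscal c * cscal d = cscal (c * d)"
  by (rule bop_eqI) (simp add: scaleC_scaleC)

lemma cscal_of_real: "cscal (of_real r) = r *\<^sub>R 1"
  by (rule bop_eqI) (simp add: scaleR_scaleC)

lemma cscal_minus: "cscal (- c) = - cscal c"
  by (rule bop_eqI) (simp add: scaleC_scaleC flip: scaleC_minus1)

lemma cscal_commute: "T * cscal c = cscal c * T"
  by (rule bop_eqI) (simp add: app_scaleC)

lemma app_bound:
  obtains K where "0 < K" "\<And>x. norm (app T x) \<le> K * norm x"
  using bounded_linear.pos_bounded[OF bounded_linear_app[of T]] by (auto simp: mult.commute)

section \<open>Positive operators\<close>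

definition pos_op :: "'a::chilbert_space bop \<Rightarrow> bool" where
  "pos_op A \<longleftrightarrow> adj A = A \<and> (\<forall>x. 0 \<le> Re (cinner x (app A x)))"

lemma pos_opD: "pos_op A \<Longrightarrow> adj A = A" "pos_op A \<Longrightarrow> 0 \<le> Re (cinner x (app A x))"
  by (auto simp: pos_op_def)

lemma pos_op_add: "pos_op A \<Longrightarrow> pos_op B \<Longrightarrow> pos_op (A + B)"
  by (simp add: pos_op_def cinner_simps)

lemma pos_op_scaleR: "0 \<le> r \<Longrightarrow> pos_op A \<Longrightarrow> pos_op (r *\<^sub>R A)"
  by (simp add: pos_op_def cinner_simps)

lemma pos_op_sandwich: "pos_op A \<Longrightarrow> pos_op (adj B * A * B)"
  by (simp add: pos_op_def mult.assoc cinner_adj_right)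

lemma pos_op_adj_mult: "pos_op (adj B * B)"
  by (simp add: pos_op_def cinner_adj_right cinner_ge_zero)

text \<open>Riesz' argument: for \<open>A\<^sub>0 = A\<close>, \<open>A\<^sub>n\<^sub>+\<^sub>1 = A\<^sub>n - A\<^sub>n\<^sup>2\<close> one has \<open>A B = \<Sum> A\<^sub>n B A\<^sub>n\<close> strongly.\<close>

lemma pos_op_mult_commute:
  assumes A: "pos_op A" "pos_op (1 - A)" and B: "pos_op B" and AB: "A * B = B * A"
  shows "pos_op (A * B)"
proof -
  define a where "a = rec_nat A (\<lambda>_ Z. Z - Z * Z)"
  have a_0: "a 0 = A" and a_Suc: "a (Suc n) = a n - a n * a n" for n
    by (simp_all add: a_def)
  have a: "pos_op (a n) \<and> pos_op (1 - a n) \<and> a n * B = B * a n" for n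
  proof (induction n)
    case 0
    then show ?case using A AB by (simp add: a_0)
  next
    case (Suc n)
    define Z where "Z = a n"
    have Z: "pos_op Z" "pos_op (1 - Z)" and ZB: "Z * B = B * Z"
      using Suc by (simp_all add: Z_def)
    have [simp]: "adj Z = Z"
      using Z(1) by (rule pos_opD)
    \<comment> \<open>Sums of sandwiches show that \<open>0 \<le> Z \<le> 1\<close> is inherited by
      \<open>Z - Z * Z\<close>.\<close>
    have "Z - Z * Z = adj Z * (1 - Z) * Z + adj (1 - Z) * Z * (1 - Z)"
      by (simp add: algebra_simps)
    moreover have "1 - (Z - Z * Z) = (1 - Z) + adj Z * Z"
      by simp
    moreover have "(Z - Z * Z) * B = B * (Z - Z * Z)"
      by (simp add: algebra_simps ZB) (simp add: ZB flip: mult.assoc)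
    ultimately show ?case
      unfolding a_Suc Z_def[symmetric]
      by (metis pos_op_add pos_op_sandwich pos_op_adj_mult Z)
  qed
  have sa: "cinner (app (a n) x) y = cinner x (app (a n) y)" for n x y
    using a[of n] cinner_adj_left[of "a n" x y] by (simp add: pos_op_def)
  have "0 \<le> Re (cinner x (app (A * B) x))" for x
  proof -
    define s where "s n = Re (cinner x (app (a n) x))" for n
    define t where "t n = Re (cinner x (app (a n) (app B x)))" for n
    have s_Suc: "s (Suc n) = s n - (norm (app (a n) x))\<^sup>2" for n
      by (simp add: s_def a_Suc cinner_simps norm_sq_cinner sa)
    \<comment> \<open>A decreasing sequence bounded below converges, so its decrements, the squared
      norms of \<open>app (a n) x\<close>, tend to 0.\<close>
    have "decseq s"
      by (rule decseq_SucI) (simp add: s_Suc)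
    moreover have "0 \<le> s n" for n
      using a[of n] by (simp add: s_def pos_op_def)
    ultimately obtain l where l: "s \<longlonglongrightarrow> l"
      using decseq_convergent[of s 0] by blast
    have "(\<lambda>n. s n - s (Suc n)) \<longlonglongrightarrow> l - l"
      by (intro tendsto_diff l LIMSEQ_Suc)
    then have "(\<lambda>n. sqrt ((norm (app (a n) x))\<^sup>2)) \<longlonglongrightarrow> sqrt 0"
      by (intro tendsto_real_sqrt) (simp add: s_Suc)
    then have "(\<lambda>n. app (a n) x) \<longlonglongrightarrow> 0"
      by (simp add: tendsto_norm_zero_iff)
    then have "(\<lambda>n. Re (cinner (app (a n) x) (app B x))) \<longlonglongrightarrow> Re (cinner 0 (app B x))"
      by (intro tendsto_Re tendsto_cinner tendsto_const)
    then have t0: "t \<longlonglongrightarrow> 0"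
      by (simp add: t_def[abs_def] sa)
    \<comment> \<open>Each decrement is a value of the quadratic form of \<open>B\<close>; since
      \<open>t\<close> decreases to 0, its first term is nonnegative.\<close>
    have "t (Suc n) \<le> t n" for n
    proof -
      have "app (a n) (app B x) = app B (app (a n) x)"
        using a[of n] by (metis app_simps(6))
      then have "t n - t (Suc n) = Re (cinner (app (a n) x) (app B (app (a n) x)))"
        by (simp add: t_def a_Suc cinner_simps sa)
      then show ?thesis
        using pos_opD(2)[OF B, of "app (a n) x"] by simp
    qed
    then have "0 \<le> t 0"
      using decseq_ge[OF decseq_SucI t0] by blast
    then show ?thesis
      by (simp add: t_def a_0)
  qed
  then show ?thesis
    using A(1) B AB by (simp add: pos_op_def)
qed

section \<open>The polar part of an operator\<close>

definition contraction :: "'a::chilbert_space bop \<Rightarrow> bool" where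
  "contraction X \<longleftrightarrow> (\<forall>x. norm (app X x) \<le> norm x)"

lemma contraction_iff_pos_op: "contraction X \<longleftrightarrow> pos_op (1 - adj X * X)"
proof -
  have "norm (app X x) \<le> norm x \<longleftrightarrow> 0 \<le> Re (cinner x (app (1 - adj X * X) x))" for x
    by (simp add: cinner_simps cinner_adj_right flip: norm_sq_cinner abs_le_square_iff)
  then show ?thesis
    by (simp add: contraction_def pos_op_def)
qed

lemma contraction_adj:
  assumes "contraction X"
  shows "contraction (adj X)"
  unfolding contraction_def
proof
  fix x
  define y where "y = app (adj X) x"
  have "(norm y)\<^sup>2 = Re (cinner (app X y) x)"
    by (simp add: norm_sq_cinner y_def cinner_adj_right)
  also have "\<dots> \<le> norm (app X y) * norm x"
    by (rule Re_cinner_le)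
  also have "\<dots> \<le> norm y * norm x"
    using assms by (simp add: contraction_def mult_right_mono)
  finally show "norm (app (adj X) x) \<le> norm x"
    by (cases "y = 0") (simp_all add: y_def power2_eq_square)
qed

text \<open>The Newton--Schulz iteration for the unitary polar factor.\<close>

definition newton_step :: "'a::chilbert_space bop \<Rightarrow> 'a bop" where
  "newton_step X = (1/2) *\<^sub>R (X + X + X - X * adj X * X)"

definition newton :: "'a::chilbert_space bop \<Rightarrow> nat \<Rightarrow> 'a bop" where
  "newton X n = (newton_step ^^ n) X"

section \<open>Contractivity and monotonicity of the iterates\<close>

lemma newton_0 [simp]: "newton X 0 = X"
  and newton_Suc: "newton X (Suc n) = newton_step (newton X n)"
  and newton_add: "newton X (n + k) = newton (newton X n) k"
  by (simp_all add: newton_def add.commute[of n] funpow_add)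

lemma adj_newton_step: "adj (newton_step X) = newton_step (adj X)"
  by (simp add: newton_step_def mult.assoc)

lemma adj_newton: "adj (newton X n) = newton (adj X) n"
  by (induction n) (simp_all add: newton_Suc adj_newton_step)

text \<open>Increment form: for a contraction the correction carries the positive factor
  \<open>1 - adj X * X\<close>.\<close>

lemma newton_step_alt: "newton_step X = X + (1/2) *\<^sub>R (X * (1 - adj X * X))"
proof -
  have "2 *\<^sub>R newton_step X = 2 *\<^sub>R (X + (1/2) *\<^sub>R (X * (1 - adj X * X)))"
    by (simp add: newton_step_def scaleR_2 scaleR_add_right algebra_simps)
  then show ?thesis by simp
qed

text \<open>With \<open>C = adj X * X\<close> this is the scalar identity
  \<open>4 - c (3 - c)^2 = (1 - c)^2 (4 - c)\<close>, whose right side is a sandwich of a positive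
  operator.\<close>

lemma contraction_newton_step:
  assumes "contraction X"
  shows "contraction (newton_step X)"
proof -
  define C where "C = adj X * X"
  have [simp]: "adj C = C"
    by (simp add: C_def)
  have C: "pos_op C" "pos_op (1 - C)"
    using assms by (simp_all add: C_def pos_op_adj_mult contraction_iff_pos_op)
  define D where "D = X + X + X - X * adj X * X"
  have "newton_step X = (1/2) *\<^sub>R D"
    by (simp add: newton_step_def D_def)
  then have "4 *\<^sub>R (1 - adj (newton_step X) * newton_step X) = 4 *\<^sub>R 1 - adj D * D"
    by (simp add: scaleR_diff_right)
  also have "4 *\<^sub>R (1::'a bop) = 1 + 1 + 1 + 1"
    using scaleR_add_left[of 2 2 "1::'a bop"] by (simp add: scaleR_2)
  also have "1 + 1 + 1 + 1 - adj D * D = adj (1 - C) * ((1 - C) + (1 + 1 + 1)) * (1 - C)"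
    by (simp add: C_def D_def algebra_simps)
  finally have "4 *\<^sub>R (1 - adj (newton_step X) * newton_step X) =
      adj (1 - C) * ((1 - C) + (1 + 1 + 1)) * (1 - C)" .
  moreover have "pos_op (1 :: 'a bop)"
    using pos_op_adj_mult[of "1::'a bop"] by simp
  ultimately have "pos_op (4 *\<^sub>R (1 - adj (newton_step X) * newton_step X))"
    using C by (simp only: pos_op_sandwich pos_op_add)
  from pos_op_scaleR[OF _ this, of "1/4"] show ?thesis
    by (simp add: contraction_iff_pos_op)
qed

lemma contraction_newton: "contraction X \<Longrightarrow> contraction (newton X n)"
  by (induction n) (simp_all add: newton_Suc contraction_newton_step)

text \<open>Each iterate is \<open>X\<close> times a real polynomial in \<open>adj X * X\<close>, so
  both products are self-adjoint. The two claims need each other in the induction.\<close>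

lemma newton_adj_commute:
  "adj X * newton X m = adj (newton X m) * X" "X * adj (newton X m) = newton X m * adj X"
proof -
  have "adj X * newton X m = adj (newton X m) * X \<and> X * adj (newton X m) = newton X m * adj X"
  proof (induction m)
    case (Suc m)
    define Z where "Z = newton X m"
    have 1: "adj X * Z = adj Z * X" and 2: "X * adj Z = Z * adj X"
      using Suc by (simp_all add: Z_def)
    have "adj X * (Z * adj Z * Z) = adj Z * (X * adj Z) * Z"
      using 1 by (simp flip: mult.assoc)
    also have "\<dots> = adj Z * Z * (adj X * Z)"
      using 2 by (simp add: mult.assoc)
    finally have 3: "adj X * (Z * adj Z * Z) = adj Z * Z * adj Z * X"
      by (simp add: 1 mult.assoc)
    have "X * (adj Z * Z * adj Z) = Z * (adj X * Z) * adj Z"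
      using 2 by (simp flip: mult.assoc)
    also have "\<dots> = Z * adj Z * (X * adj Z)"
      using 1 by (simp add: mult.assoc)
    finally have 4: "X * (adj Z * Z * adj Z) = Z * adj Z * Z * adj X"
      by (simp add: 2 mult.assoc)
    show ?case
      unfolding newton_Suc Z_def[symmetric] using 1 2 3 4
      by (simp add: newton_step_def distrib_left distrib_right left_diff_distrib
          right_diff_distrib mult.assoc)
  qed simp
  then show "adj X * newton X m = adj (newton X m) * X" "X * adj (newton X m) = newton X m * adj X"
    by auto
qed

text \<open>Every step adds to \<open>adj X * newton X m\<close> half the product of two commuting
  positive operators.\<close>

lemma newton_ge:
  assumes "contraction X"
  shows "pos_op (adj X * newton X m - adj X * X)"
proof (induction m)
  case 0
  then show ?case by (simp add: pos_op_def)
next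
  case (Suc m)
  define Z Y C where "Z = newton X m" and "Y = adj X * Z" and "C = adj Z * Z"
  have "Y * C = adj X * Z * adj Z * Z"
    by (simp add: Y_def C_def mult.assoc)
  also have "\<dots> = adj Z * (X * adj Z) * Z"
    by (simp add: newton_adj_commute(1) Z_def mult.assoc)
  also have "\<dots> = C * Y"
    unfolding Z_def newton_adj_commute(2) by (simp add: Y_def C_def Z_def mult.assoc)
  finally have YC: "(1 - C) * Y = Y * (1 - C)"
    by (simp add: algebra_simps)
  have C: "pos_op (1 - C)" "pos_op (1 - (1 - C))"
    using contraction_newton[OF assms, of m]
    by (simp_all add: C_def Z_def contraction_iff_pos_op pos_op_adj_mult)
  have YX: "pos_op (Y - adj X * X)"
    using Suc by (simp add: Y_def Z_def)
  then have "pos_op Y"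
    using pos_op_add[OF YX pos_op_adj_mult[of X]] by simp
  then have "pos_op ((1 - C) * Y)"
    using C YC by (intro pos_op_mult_commute)
  then have "pos_op ((Y - adj X * X) + (1/2) *\<^sub>R (Y * (1 - C)))"
    unfolding YC using YX by (intro pos_op_add pos_op_scaleR) simp_all
  also have "(Y - adj X * X) + (1/2) *\<^sub>R (Y * (1 - C)) = adj X * newton X (Suc m) - adj X * X"
    by (simp add: newton_Suc newton_step_alt distrib_left Y_def C_def Z_def mult.assoc)
  finally show ?case .
qed

text \<open>By \<open>newton_ge\<close>, started at the \<open>n\<close>-th iterate, the mixed term
  in the squared norm of the difference is at least the smaller squared norm.\<close>

lemma newton_increment:
  assumes "contraction X" "n \<le> m"
  shows "(norm (app (newton X m) x - app (newton X n) x))\<^sup>2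
    \<le> (norm (app (newton X m) x))\<^sup>2 - (norm (app (newton X n) x))\<^sup>2"
proof -
  define Z where "Z = newton X n"
  have m: "newton X m = newton Z (m - n)"
    using assms(2) newton_add[of X n "m - n"] by (simp add: Z_def)
  have "contraction Z"
    using assms(1) by (simp add: Z_def contraction_newton)
  then have "0 \<le> Re (cinner x (app (adj Z * newton Z (m - n) - adj Z * Z) x))"
    by (intro pos_opD newton_ge)
  then have "(norm (app Z x))\<^sup>2 \<le> Re (cinner (app Z x) (app (newton X m) x))"
    by (simp add: cinner_simps cinner_adj_right norm_sq_cinner m)
  then show ?thesis
    using Re_cinner_commute[of "app Z x"] by (simp add: norm_diff_sq Z_def)
qed

lemma newton_norm_mono:
  assumes "contraction X"
  shows "incseq (\<lambda>n. (norm (app (newton X n) x))\<^sup>2)"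
  unfolding incseq_def
proof (intro allI impI)
  fix n m :: nat
  assume "n \<le> m"
  from order_trans[OF zero_le_power2 newton_increment[OF assms this]]
  show "(norm (app (newton X n) x))\<^sup>2 \<le> (norm (app (newton X m) x))\<^sup>2"
    by simp
qed

text \<open>The squared norms increase and are bounded, hence Cauchy, and they control the
  differences of the vectors.\<close>

lemma newton_Cauchy:
  assumes "contraction X"
  shows "Cauchy (\<lambda>n. app (newton X n) x)"
proof (rule metric_CauchyI)
  fix e :: real assume "0 < e"
  define r where "r n = (norm (app (newton X n) x))\<^sup>2" for n
  have "r n \<le> (norm x)\<^sup>2" for n
    using contraction_newton[OF assms, of n] by (simp add: r_def contraction_def)
  then have "convergent r"
    using incseq_convergent[OF newton_norm_mono[OF assms]] unfolding r_def convergent_def by metis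
  then have "Cauchy r"
    by (rule convergent_Cauchy)
  then obtain N where N: "\<And>k l. N \<le> k \<Longrightarrow> N \<le> l \<Longrightarrow> dist (r k) (r l) < e\<^sup>2"
    using \<open>0 < e\<close> unfolding Cauchy_def by (metis zero_less_power)
  have 1: "dist (app (newton X k) x) (app (newton X l) x) < e" if "N \<le> l" "l \<le> k" for k l
  proof -
    have "(norm (app (newton X k) x - app (newton X l) x))\<^sup>2 \<le> r k - r l"
      unfolding r_def by (rule newton_increment[OF assms that(2)])
    also have "\<dots> < e\<^sup>2"
      using N[of k l] that by (simp add: dist_real_def)
    finally show ?thesis
      using \<open>0 < e\<close> by (simp add: dist_norm power_less_imp_less_base)
  qed
  show "\<exists>M. \<forall>k\<ge>M. \<forall>l\<ge>M. dist (app (newton X k) x) (app (newton X l) x) < e"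
    using 1 by (metis dist_commute nle_le)
qed

section \<open>Strong limits and the polar factor\<close>

lemma strong_limit_contraction:
  assumes "\<And>n. contraction (Y n)" "\<And>x. Cauchy (\<lambda>n. app (Y n) x)"
  shows "\<exists>U. contraction U \<and> (\<forall>x. (\<lambda>n. app (Y n) x) \<longlonglongrightarrow> app U x)"
proof -
  have "\<exists>l. (\<lambda>n. app (Y n) x) \<longlonglongrightarrow> l" for x
    using assms(2)[of x] by (simp add: Cauchy_convergent_iff convergent_def)
  then obtain u where u: "\<And>x. (\<lambda>n. app (Y n) x) \<longlonglongrightarrow> u x"
    by metis
  have le: "norm (u x) \<le> norm x" for x
    using LIMSEQ_le_const2[OF tendsto_norm[OF u]] assms(1) by (auto simp: contraction_def)
  have "bounded_clinear_op u"
  proof (rule bounded_clinear_opI)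
    fix x y
    have "(\<lambda>n. app (Y n) (x + y)) \<longlonglongrightarrow> u x + u y"
      unfolding app_add by (intro tendsto_add u)
    then show "u (x + y) = u x + u y"
      using u LIMSEQ_unique by blast
  next
    fix c x
    have "(\<lambda>n. app (cscal c) (app (Y n) x)) \<longlonglongrightarrow> app (cscal c) (u x)"
      by (intro bounded_linear.tendsto[OF bounded_linear_app] u)
    then have "(\<lambda>n. app (Y n) (scaleC c x)) \<longlonglongrightarrow> scaleC c (u x)"
      by (simp add: app_scaleC)
    then show "u (scaleC c x) = scaleC c (u x)"
      using u LIMSEQ_unique by blast
  next
    show "norm (u x) \<le> norm x * 1" for x
      using le by simp
  qed
  then have "app (Bop u) = u"
    by (simp add: Bop_inverse)
  then show ?thesis
    using u le by (intro exI[of _ "Bop u"]) (simp add: contraction_def)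
qed

text \<open>The uniform bound lets operator and vector vary together, so products of strongly
  convergent contractions converge strongly.\<close>

lemma contraction_tendsto:
  assumes "\<And>n. contraction (Y n)" "\<And>x. (\<lambda>n. app (Y n) x) \<longlonglongrightarrow> app U x" "v \<longlonglongrightarrow> w"
  shows "(\<lambda>n. app (Y n) (v n)) \<longlonglongrightarrow> app U w"
proof -
  have "(\<lambda>n. app (Y n) (v n - w)) \<longlonglongrightarrow> 0"
  proof (rule Lim_null_comparison)
    show "eventually (\<lambda>n. norm (app (Y n) (v n - w)) \<le> norm (v n - w)) sequentially"
      using assms(1) by (simp add: contraction_def)
    show "(\<lambda>n. norm (v n - w)) \<longlonglongrightarrow> 0"
      using assms(3) by (simp add: tendsto_norm_zero LIM_zero)
  qed
  from tendsto_add[OF this assms(2)[of w]] show ?thesis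
    by (simp add: app_diff)
qed

text \<open>The iteration contains \<open>adj Z\<close>; taking adjoints of the relation for
  \<open>adj B\<close> moves \<open>B\<close> across that factor.\<close>

lemma newton_intertwine:
  assumes "B * X = X * C" "adj B * X = X * adj C"
  shows "B * newton X n = newton X n * C \<and> adj B * newton X n = newton X n * adj C"
proof (induction n)
  case 0
  then show ?case using assms by simp
next
  case (Suc n)
  define Z where "Z = newton X n"
  have 1: "B * Z = Z * C" "adj B * Z = Z * adj C"
    using Suc by (simp_all add: Z_def)
  then have 2: "adj Z * B = C * adj Z" "adj Z * adj B = adj C * adj Z"
    by (metis adj_adj adj_simps(6))+
  have "B * (Z * adj Z * Z) = Z * (C * adj Z) * Z"
    using 1 by (simp flip: mult.assoc)
  also have "\<dots> = Z * adj Z * Z * C"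
    by (simp add: 1 mult.assoc flip: 2)
  finally have 3: "B * (Z * adj Z * Z) = Z * adj Z * Z * C" .
  have "adj B * (Z * adj Z * Z) = Z * (adj C * adj Z) * Z"
    using 1 by (simp flip: mult.assoc)
  also have "\<dots> = Z * adj Z * Z * adj C"
    by (simp add: 1 mult.assoc flip: 2)
  finally have 4: "adj B * (Z * adj Z * Z) = Z * adj Z * Z * adj C" .
  show ?case
    unfolding newton_Suc Z_def[symmetric] using 1 3 4
    by (simp add: newton_step_def distrib_left distrib_right left_diff_distrib
        right_diff_distrib mult.assoc)
qed

lemma newton_kernel: "app X x = 0 \<Longrightarrow> app (newton X n) x = 0"
  by (induction n) (simp_all add: newton_Suc newton_step_def)

text \<open>An interface to the partial isometry in the polar decomposition: its kernels, the
  intertwining relations it inherits, and self-adjointness, without the positive factor.\<close>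

definition polar_part :: "'a::chilbert_space bop \<Rightarrow> 'a bop \<Rightarrow> bool" where
  "polar_part X U \<longleftrightarrow> U * adj U * U = U
    \<and> (\<forall>x. app U x = 0 \<longleftrightarrow> app X x = 0) \<and> (\<forall>x. app (adj U) x = 0 \<longleftrightarrow> app (adj X) x = 0)
    \<and> (\<forall>B C. B * X = X * C \<longrightarrow> adj B * X = X * adj C \<longrightarrow> B * U = U * C)
    \<and> (adj X = X \<longrightarrow> adj U = U)"

lemma polar_part_contraction:
  assumes X: "contraction X"
  shows "\<exists>U. polar_part X U"
proof -
  let ?Y = "newton X"
  note cY = contraction_newton[OF X]
  obtain U where U: "contraction U" "\<And>x. (\<lambda>n. app (?Y n) x) \<longlonglongrightarrow> app U x"
    using strong_limit_contraction[OF cY newton_Cauchy[OF X]] by blast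
  have cY': "contraction (adj (?Y n))" for n
    using cY by (rule contraction_adj)
  \<comment> \<open>Strong convergence need not survive adjoints in general; here the adjoints are
    the iterates of \<open>adj X\<close>, which converge too.\<close>
  obtain V where V: "contraction V" "\<And>x. (\<lambda>n. app (adj (?Y n)) x) \<longlonglongrightarrow> app V x"
    using strong_limit_contraction[of "\<lambda>n. adj (?Y n)"] cY' newton_Cauchy[OF contraction_adj[OF X]]
    by (auto simp: adj_newton)
  have "V = adj U"
  proof (rule adjI)
    fix x y
    have "(\<lambda>n. cinner (app (?Y n) x) y) \<longlonglongrightarrow> cinner (app U x) y"
      by (intro tendsto_cinner U tendsto_const)
    moreover have "(\<lambda>n. cinner (app (?Y n) x) y) \<longlonglongrightarrow> cinner x (app V y)"
      by (simp only: cinner_adj_right[symmetric]) (intro tendsto_cinner V tendsto_const)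
    ultimately show "cinner (app U x) y = cinner x (app V y)"
      by (rule LIMSEQ_unique)
  qed
  note V = V[unfolded this]
  \<comment> \<open>The norms along the iteration increase from that of \<open>app Z x\<close>, so a
    zero limit forces a zero start.\<close>
  have ker: "app W x = 0 \<longleftrightarrow> app Z x = 0"
    if "contraction Z" "(\<lambda>n. app (newton Z n) x) \<longlonglongrightarrow> app W x" for Z W x
  proof
    assume "app W x = 0"
    then have "(\<lambda>n. (norm (app (newton Z n) x))\<^sup>2) \<longlonglongrightarrow> 0"
      using tendsto_power[OF tendsto_norm[OF that(2)], of 2] by simp
    from incseq_le[OF newton_norm_mono[OF that(1)] this, of 0] show "app Z x = 0"
      by simp
  next
    assume "app Z x = 0"
    then show "app W x = 0"
      using that(2) by (simp add: newton_kernel LIMSEQ_const_iff)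
  qed
  have 1: "U * adj U * U = U"
  proof (rule bop_eqI)
    fix x
    \<comment> \<open>Passing to the limit in the recursion makes \<open>U\<close> a fixed point of
      the Newton step.\<close>
    have "(\<lambda>n. app (?Y n) (app (adj (?Y n)) (app (?Y n) x))) \<longlonglongrightarrow> app U (app (adj U) (app U x))"
      by (rule contraction_tendsto[OF cY U(2) contraction_tendsto[OF cY' V(2) U(2)]])
    then have "(\<lambda>n. app (?Y (Suc n)) x) \<longlonglongrightarrow>
        (1/2) *\<^sub>R (app U x + app U x + app U x - app U (app (adj U) (app U x)))"
      unfolding newton_Suc newton_step_def app_simps
      by (intro tendsto_intros U)
    moreover have "(\<lambda>n. app (?Y (Suc n)) x) \<longlonglongrightarrow> app U x"
      by (intro LIMSEQ_Suc U)
    ultimately have "app U x =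
        (1/2) *\<^sub>R (app U x + app U x + app U x - app U (app (adj U) (app U x)))"
      using LIMSEQ_unique by blast
    then have "2 *\<^sub>R app U x =
        2 *\<^sub>R (1/2) *\<^sub>R (app U x + app U x + app U x - app U (app (adj U) (app U x)))"
      by metis
    then show "app (U * adj U * U) x = app U x"
      by (simp add: scaleR_2 algebra_simps)
  qed
  have 2: "app U x = 0 \<longleftrightarrow> app X x = 0" for x
    by (rule ker[OF X U(2)])
  have 3: "app (adj U) x = 0 \<longleftrightarrow> app (adj X) x = 0" for x
    using ker[OF contraction_adj[OF X], of x "adj U"] V(2) by (simp add: adj_newton)
  have 4: "B * U = U * C" if "B * X = X * C" "adj B * X = X * adj C" for B C
  proof (rule bop_eqI)
    fix x
    have "(\<lambda>n. app B (app (?Y n) x)) \<longlonglongrightarrow> app B (app U x)"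
      by (intro bounded_linear.tendsto[OF bounded_linear_app] U)
    moreover have "app B (app (?Y n) x) = app (?Y n) (app C x)" for n
      using newton_intertwine[OF that, of n] by (metis app_simps(6))
    ultimately show "app (B * U) x = app (U * C) x"
      using LIMSEQ_unique[OF U(2)[of "app C x"]] by simp
  qed
  have 5: "adj U = U" if "adj X = X"
  proof (rule bop_eqI)
    fix x
    show "app (adj U) x = app U x"
      using LIMSEQ_unique[OF U(2)[of x]] V(2)[of x] by (simp add: adj_newton that)
  qed
  show ?thesis
    unfolding polar_part_def
    by (intro exI[of _ U] conjI allI impI 1 2 3 4 5)
qed

text \<open>Division by a bound gives a contraction, and every clause of \<open>polar_part\<close>
  is invariant under positive scaling.\<close>

lemma polar_part_exists: "\<exists>U. polar_part X U"
proof -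
  obtain K where K: "0 < K" "\<And>x. norm (app X x) \<le> K * norm x"
    using app_bound[of X] by blast
  have "contraction ((1/K) *\<^sub>R X)"
    using K by (simp add: contraction_def field_simps)
  then obtain U where "polar_part ((1/K) *\<^sub>R X) U"
    using polar_part_contraction by blast
  then have "polar_part X U"
    using K(1) by (simp add: polar_part_def)
  then show ?thesis ..
qed

section \<open>The Fuglede--Putnam theorem\<close>

lemma power_mult_commuting:
  fixes a b :: "'a::monoid_mult"
  assumes "a * b = b * a"
  shows "(a * b) ^ n = a ^ n * b ^ n"
proof (induction n)
  case (Suc n)
  have "b * a ^ n = a ^ n * b"
    using power_commuting_commutes[of a b n] assms by simp
  then have "a * (b * (a ^ n * b ^ n)) = a * (a ^ n * (b * b ^ n))"
    by (metis mult.assoc)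
  then show ?case
    using Suc by (simp add: mult.assoc)
qed simp

lemma power_intertwine:
  fixes a b c :: "'a::monoid_mult"
  assumes "a * c = c * b"
  shows "a ^ n * c = c * b ^ n"
proof (induction n)
  case (Suc n)
  have "a ^ Suc n * c = a * (c * b ^ n)"
    using Suc by (simp add: mult.assoc)
  also have "\<dots> = c * (b * b ^ n)"
    using assms by (simp flip: mult.assoc)
  finally show ?case by simp
qed simp

lemma norm_app_power:
  assumes "\<And>x. norm (app Z x) \<le> c * norm x" "0 \<le> c"
  shows "norm (app (Z ^ n) x) \<le> c ^ n * norm x"
proof (induction n)
  case (Suc n)
  have "norm (app (Z ^ Suc n) x) \<le> c * norm (app (Z ^ n) x)"
    using assms(1) by simp
  also have "\<dots> \<le> c * (c ^ n * norm x)"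
    using Suc assms(2) by (rule mult_left_mono)
  finally show ?case by simp
qed simp

text \<open>For \<open>z\<close> of order \<open>1 / n^2\<close> the bound tends to 0, so the
  \<open>n\<close>-th power approaches the identity.\<close>

lemma norm_app_power_minus_1:
  assumes Z: "\<And>x. norm (app Z x) \<le> z * norm x" and "0 \<le> z"
  shows "norm (app ((1 - Z) ^ n) x - x) \<le> ((1 + z) ^ n - 1) * norm x"
proof (induction n)
  case (Suc n)
  define v where "v = app ((1 - Z) ^ n) x"
  have le1: "norm (app (1 - Z) y) \<le> (1 + z) * norm y" for y
    using norm_triangle_ineq4[of y "app Z y"] Z[of y] by (simp add: distrib_right)
  have "norm (app Z v) \<le> z * ((1 + z) ^ n * norm x)"
    using Z[of v] mult_left_mono[OF norm_app_power[OF le1, of n x] \<open>0 \<le> z\<close>] \<open>0 \<le> z\<close>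
    by (simp add: v_def)
  moreover have "norm (app ((1 - Z) ^ Suc n) x - x) \<le> norm (v - x) + norm (app Z v)"
    using norm_triangle_ineq4[of "v - x" "app Z v"] by (simp add: v_def algebra_simps)
  ultimately show ?case
    using Suc by (simp add: v_def algebra_simps)
qed simp

text \<open>The product is \<open>1 + S\<close> minus a term of second order, with \<open>S\<close>
  skew-adjoint. Since \<open>x\<close> and \<open>app S x\<close> are orthogonal in the real sense,
  \<open>S\<close> too changes the norm only to second order.\<close>

lemma norm_near_unitary:
  fixes \<mu> :: complex
  assumes A: "adj A * A = A * adj A"
    and K: "\<And>x. norm (app A x) \<le> K * norm x" "\<And>x. norm (app (adj A) x) \<le> K * norm x" "0 \<le> K"
  shows "norm (app ((1 + cscal \<mu> * adj A) * (1 - cscal (cnj \<mu>) * A)) x)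
    \<le> (1 + 3 * (cmod \<mu> * K)\<^sup>2) * norm x"
proof -
  define S where "S = cscal \<mu> * adj A - cscal (cnj \<mu>) * A"
  define t where "t = cmod \<mu> * K"
  have "0 \<le> t" using K by (simp add: t_def)
  have S_skew: "adj S = - S"
    by (simp add: S_def cscal_commute)
  have "Re (cinner x (app S x)) = 0"
    using arg_cong[OF cinner_adj_right[of x S x], of Re] Re_cinner_commute[of x "app S x"] by (simp add: S_skew)
  then have eq: "(norm (x + app S x))\<^sup>2 = (norm x)\<^sup>2 + (norm (app S x))\<^sup>2"
    by (simp add: norm_add_sq)
  have "norm (app S x) \<le> cmod \<mu> * norm (app (adj A) x) + cmod \<mu> * norm (app A x)"
    using norm_triangle_ineq4[of "scaleC \<mu> (app (adj A) x)" "scaleC (cnj \<mu>) (app A x)"]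
    by (simp add: S_def norm_scaleC)
  also have "\<dots> \<le> cmod \<mu> * (K * norm x) + cmod \<mu> * (K * norm x)"
    by (intro add_mono mult_left_mono K) simp_all
  finally have "norm (app S x) \<le> 2 * t * norm x"
    by (simp add: t_def mult_ac)
  then have "(norm (x + app S x))\<^sup>2 \<le> (norm x)\<^sup>2 + (2 * t * norm x)\<^sup>2"
    unfolding eq by (intro add_left_mono power_mono) simp_all
  also have "\<dots> \<le> ((1 + 2 * t\<^sup>2) * norm x)\<^sup>2"
  proof -
    have "0 \<le> 4 * (t\<^sup>2 * t\<^sup>2) * (norm x)\<^sup>2" by simp
    then show ?thesis by (simp add: power_mult_distrib power2_sum algebra_simps power2_eq_square)
  qed
  finally have 1: "norm (x + app S x) \<le> (1 + 2 * t\<^sup>2) * norm x"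
    by (rule power2_le_imp_le) simp
  have "cmod \<mu> * (cmod \<mu> * norm (app (adj A) (app A x))) \<le> cmod \<mu> * (cmod \<mu> * (K * (K * norm x)))"
    by (intro mult_left_mono order_trans[OF K(2) mult_left_mono[OF K(1) K(3)]]) simp_all
  then have 2: "norm (scaleC (\<mu> * cnj \<mu>) (app (adj A) (app A x))) \<le> t\<^sup>2 * norm x"
    by (simp add: norm_scaleC norm_mult t_def power2_eq_square algebra_simps)
  have split: "app ((1 + cscal \<mu> * adj A) * (1 - cscal (cnj \<mu>) * A)) x
      = (x + app S x) - scaleC (\<mu> * cnj \<mu>) (app (adj A) (app A x))"
    by (simp add: S_def app_diff app_scaleC scaleC_diff_right scaleC_add_right scaleC_scaleC
        mult.commute)
  show ?thesis
    unfolding split t_def[symmetric]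
    using norm_triangle_ineq4[of "x + app S x" "scaleC (\<mu> * cnj \<mu>) (app (adj A) (app A x))"] 1 2
    by (simp add: distrib_right)
qed

text \<open>Testing against each \<open>y\<close> reduces vector-valued functions to scalar complex
  analysis; \<open>v\<close> and \<open>w\<close> are the value and derivative at 0.\<close>

definition weakly_entire :: "(complex \<Rightarrow> 'a::chilbert_space) \<Rightarrow> 'a \<Rightarrow> 'a \<Rightarrow> bool" where
  "weakly_entire f v w \<longleftrightarrow> f 0 = v \<and> (\<forall>y. (\<lambda>l. cinner y (f l)) holomorphic_on UNIV \<and>
     ((\<lambda>l. cinner y (f l)) has_field_derivative cinner y w) (at 0))"

lemma weakly_entire_const: "weakly_entire (\<lambda>_. v) v 0"
  by (simp add: weakly_entire_def)

lemma weakly_entire_app: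
  assumes "weakly_entire f v w"
  shows "weakly_entire (\<lambda>l. app T (f l)) (app T v) (app T w)"
  using assms unfolding weakly_entire_def by (simp flip: cinner_adj_left)

lemma weakly_entire_step:
  assumes f: "weakly_entire f v w"
  shows "weakly_entire (\<lambda>l. app (1 + cscal (l * c) * T) (f l)) v (w + scaleC c (app T v))"
  unfolding weakly_entire_def
proof (intro conjI allI)
  note Tf = weakly_entire_app[OF f, of T]
  show "app (1 + cscal (0 * c) * T) (f 0) = v"
    using f by (simp add: weakly_entire_def)
  fix y
  have eq: "cinner y (app (1 + cscal (l * c) * T) (f l))
      = cinner y (f l) + l * c * cinner y (app T (f l))" for l
    by (simp add: cinner_simps)
  show "(\<lambda>l. cinner y (app (1 + cscal (l * c) * T) (f l))) holomorphic_on UNIV"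
    unfolding eq using f Tf by (intro holomorphic_intros) (auto simp: weakly_entire_def)
  have f': "((\<lambda>l. cinner y (f l)) has_field_derivative cinner y w) (at 0)"
    and Tf': "((\<lambda>l. cinner y (app T (f l))) has_field_derivative cinner y (app T w)) (at 0)"
    using f Tf by (auto simp: weakly_entire_def)
  show "((\<lambda>l. cinner y (app (1 + cscal (l * c) * T) (f l))) has_field_derivative
      cinner y (w + scaleC c (app T v))) (at 0)"
    unfolding eq using f by (auto intro!: derivative_eq_intros f' Tf' simp: weakly_entire_def cinner_simps)
qed

text \<open>Each factor is the identity at 0, so by the product rule the \<open>n\<close>
  contributions to the derivative add up.\<close>

lemma weakly_entire_power:
  assumes "weakly_entire f v w"
  shows "weakly_entire (\<lambda>l. app ((1 + cscal (l * c) * T) ^ n) (f l)) v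
    (w + scaleC (of_nat n * c) (app T v))"
proof (induction n)
  case 0
  then show ?case using assms by simp
next
  case (Suc n)
  have "w + scaleC (of_nat (Suc n) * c) (app T v)
      = (w + scaleC (of_nat n * c) (app T v)) + scaleC c (app T v)"
    by (simp add: scaleC_add_left distrib_right add_ac)
  then show ?case
    using weakly_entire_step[OF Suc, of c T] by (simp add: add.assoc)
qed

text \<open>Testing against \<open>w\<close> itself turns the scalar Cauchy inequality into a bound
  on the norm of \<open>w\<close>.\<close>

lemma weakly_entire_Cauchy_bound:
  assumes f: "weakly_entire f v w" and "0 < R" and bound: "\<And>l. cmod l = R \<Longrightarrow> norm (f l) \<le> M"
  shows "norm w \<le> M / R"
proof (cases "w = 0")
  case True
  have "0 \<le> norm (f (of_real R))" by simp
  also have "\<dots> \<le> M" using \<open>0 < R\<close> by (intro bound) simp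
  finally show ?thesis using True \<open>0 < R\<close> by simp
next
  case False
  define h where "h l = cinner w (f l)" for l
  have h: "h holomorphic_on UNIV" "(h has_field_derivative cinner w w) (at 0)"
    using f by (auto simp: weakly_entire_def h_def[abs_def])
  have "norm ((deriv ^^ 1) h 0) \<le> fact 1 * (norm w * M) / R ^ 1"
  proof (rule Cauchy_inequality)
    show "continuous_on (cball 0 R) h" "h holomorphic_on ball 0 R"
      using h(1) by (auto intro: holomorphic_on_imp_continuous_on holomorphic_on_subset)
    fix l assume "cmod (0 - l) = R"
    then have "norm w * norm (f l) \<le> norm w * M"
      using bound by (intro mult_left_mono) simp_all
    then show "norm (h l) \<le> norm w * M"
      using cinner_Cauchy_Schwarz[of w "f l"] unfolding h_def by linarith
  qed (use \<open>0 < R\<close> in auto)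
  moreover have "deriv h 0 = of_real ((norm w)\<^sup>2)"
    using DERIV_imp_deriv[OF h(2)] by (simp add: cinner_self)
  ultimately have "norm w * norm w \<le> norm w * (M / R)"
    by (simp add: power2_eq_square norm_mult)
  then show ?thesis
    by (rule mult_left_le_imp_le) (use False in simp)
qed

text \<open>Rosenblum's argument, with \<open>exp (\<lambda> A*)\<close> replaced by \<open>(1 + \<lambda> A* / n) ^ n\<close>. On each circle
  the vector polynomial \<open>(1 + \<lambda> A* / n) ^ n X (1 - \<lambda> B* / n) ^ n x\<close> is asymptotically bounded by
  \<open>\<parallel>X\<parallel> \<parallel>x\<parallel>\<close>, and its linear coefficient \<open>(A* X - X B*) x\<close> does not depend on \<open>n\<close>.\<close>

theorem fuglede_putnam:
  assumes A: "adj A * A = A * adj A" and B: "adj B * B = B * adj B" and AX: "A * X = X * B"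
  shows "adj A * X = X * adj B"
proof -
  obtain K where "0 < K" and K: "\<And>x. norm (app A x) \<le> K * norm x"
    "\<And>x. norm (app (adj A) x) \<le> K * norm x" "\<And>x. norm (app B x) \<le> K * norm x"
    "\<And>x. norm (app (adj B) x) \<le> K * norm x" "\<And>x. norm (app X x) \<le> K * norm x"
  proof -
    have "\<forall>T. \<exists>k>0. \<forall>x. norm (app T x) \<le> k * norm x"
      using app_bound by metis
    then obtain k where k: "\<And>T::'a bop. 0 < k T" "\<And>T x. norm (app T x) \<le> k T * norm x"
      by metis
    define L where "L = k A + k (adj A) + k B + k (adj B) + k X"
    have "k T * norm x \<le> L * norm x" if "T \<in> {A, adj A, B, adj B, X}" for T x
      using that k(1)[of A] k(1)[of "adj A"] k(1)[of B] k(1)[of "adj B"] k(1)[of X]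
      by (intro mult_right_mono) (auto simp: L_def)
    then have "norm (app T x) \<le> L * norm x" if "T \<in> {A, adj A, B, adj B, X}" for T x
      using k(2)[of T x] that by (meson order_trans)
    moreover have "0 < L"
      using k(1) by (simp add: L_def add_pos_pos)
    ultimately show thesis
      by (intro that[of L]) auto
  qed
  have bound: "norm (app ((1 + cscal (l / of_nat n) * adj A) ^ n * X * (1 - cscal (l / of_nat n) * adj B) ^ n) x)
      \<le> (K * exp (6 * (R * K)\<^sup>2 / real n) + K * exp (2 * R * K) * (exp ((R * K)\<^sup>2 / real n) - 1)) * norm x"
    if "cmod l = R" "0 < n" "0 < R" for l R n x
  proof -
    define \<mu> where "\<mu> = l / of_nat n"
    define t where "t = cmod \<mu> * K"
    have t: "0 \<le> t" "real n * t = R * K"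
      using that \<open>0 < K\<close> by (simp_all add: t_def \<mu>_def norm_divide)
    then have t2: "real n * t\<^sup>2 = (R * K)\<^sup>2 / n"
      using that by (simp add: power2_eq_square field_simps)
    \<comment> \<open>The product to be bounded is \<open>p ^ n * X * q' ^ n\<close>. The partners
      \<open>p'\<close> and \<open>q\<close> make \<open>p * p'\<close> and \<open>q' * q\<close>
      nearly isometric, \<open>q''\<close> is what \<open>p'\<close> becomes across
      \<open>X\<close>, and \<open>W\<close> is the second-order defect of
      \<open>q'' * q\<close>.\<close>
    define p p' q q' q'' W where "p = 1 + cscal \<mu> * adj A" and "p' = 1 - cscal (cnj \<mu>) * A"
      and "q = 1 + cscal (cnj \<mu>) * B" and "q' = 1 - cscal \<mu> * adj B"
      and "q'' = 1 - cscal (cnj \<mu>) * B" and "W = cscal (cnj \<mu>) * cscal (cnj \<mu>) * (B * B)"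
    have pp': "norm (app ((p * p') ^ n) x) \<le> (1 + 3 * t\<^sup>2) ^ n * norm x" for x
      unfolding p_def p'_def t_def
      by (intro norm_app_power norm_near_unitary A K) (simp_all add: \<open>0 < K\<close> less_imp_le)
    have "norm (app ((1 + cscal (- \<mu>) * adj B) * (1 - cscal (cnj (- \<mu>)) * B)) x)
        \<le> (1 + 3 * (cmod (- \<mu>) * K)\<^sup>2) * norm x" for x
      by (intro norm_near_unitary B K) (simp add: \<open>0 < K\<close> less_imp_le)
    then have q'q: "norm (app (q' * q) x) \<le> (1 + 3 * t\<^sup>2) * norm x" for x
      by (simp add: cscal_minus q'_def q_def t_def)
    have scal: "cscal c * a * (cscal d * b) = cscal c * cscal d * (a * b)" for a b :: "'a bop" and c d
      by (metis cscal_commute mult.assoc)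
    have cc: "cscal c * cscal d = (cscal d * cscal c :: 'a bop)" for c d
      by (rule cscal_commute)
    have "p * p' = p' * p" "q' * q = q * q'" "q'' * q = 1 - W" "p' * X = X * q''"
      by (simp_all add: p_def p'_def q_def q'_def q''_def W_def ring_distribs scal A B cc[of \<mu>])
         (metis AX cscal_commute mult.assoc)
    note rel = this
    have "norm (app W x) \<le> t\<^sup>2 * norm x" for x
    proof -
      have "cmod \<mu> * (cmod \<mu> * norm (app B (app B x))) \<le> cmod \<mu> * (cmod \<mu> * (K * (K * norm x)))"
        using \<open>0 < K\<close> by (intro mult_left_mono order_trans[OF K(3) mult_left_mono[OF K(3)]]) simp_all
      then show ?thesis
        by (simp add: W_def norm_scaleC t_def power2_eq_square algebra_simps)
    qed
    note W = norm_app_power_minus_1[of W "t\<^sup>2", OF this, of n]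
    have "norm (app p x) \<le> (1 + t) * norm x" "norm (app q' x) \<le> (1 + t) * norm x" for x
      using norm_triangle_ineq[of x "scaleC \<mu> (app (adj A) x)"] mult_left_mono[OF K(2)[of x], of "cmod \<mu>"]
        norm_triangle_ineq4[of x "scaleC \<mu> (app (adj B) x)"] mult_left_mono[OF K(4)[of x], of "cmod \<mu>"]
      by (simp_all add: p_def q'_def t_def norm_scaleC algebra_simps)
    then have pn: "norm (app (p ^ n) x) \<le> (1 + t) ^ n * norm x"
      and qn: "norm (app (q' ^ n) x) \<le> (1 + t) ^ n * norm x" for x
      using t(1) by (simp_all add: norm_app_power)
    have exp_bound: "(1 + s) ^ n \<le> exp (real n * s)" if "0 \<le> s" for s :: real
      using power_mono[OF exp_ge_add_one_self[of s], of n] that by (simp add: exp_of_nat_mult)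

    \<comment> \<open>Normality separates the powers, and moving \<open>p' ^ n\<close> across
      \<open>X\<close> nearly cancels it against \<open>q ^ n\<close>.\<close>
    have "(p * p') ^ n * X * (q' * q) ^ n = p ^ n * (p' ^ n * X) * (q ^ n * q' ^ n)"
      using power_mult_commuting[OF rel(1), of n] power_mult_commuting[OF rel(2)[symmetric], of n]
      by (simp add: rel(2) mult.assoc)
    also have "\<dots> = p ^ n * X * (q'' ^ n * q ^ n) * q' ^ n"
      by (simp add: power_intertwine[OF rel(4)] mult.assoc)
    also have "q'' ^ n * q ^ n = (1 - W) ^ n"
    proof -
      have "q'' * q = q * q''"
        by (simp add: q_def q''_def ring_distribs)
      then show ?thesis
        using power_mult_commuting[of q'' q n] rel(3) by simp
    qed
    finally have split: "p ^ n * X * q' ^ n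
        = (p * p') ^ n * X * (q' * q) ^ n - p ^ n * X * ((1 - W) ^ n - 1) * q' ^ n"
      by (simp add: algebra_simps)

    have "norm (app ((p * p') ^ n * X * (q' * q) ^ n) x) \<le> (1 + 3 * t\<^sup>2) ^ n * (K * ((1 + 3 * t\<^sup>2) ^ n * norm x))"
    proof -
      have "norm (app X (app ((q' * q) ^ n) x)) \<le> K * ((1 + 3 * t\<^sup>2) ^ n * norm x)"
        using \<open>0 < K\<close>
        by (intro order_trans[OF K(5) mult_left_mono] norm_app_power q'q) simp_all
      from order_trans[OF pp' mult_left_mono[OF this]] show ?thesis
        by simp
    qed
    also have "\<dots> \<le> exp (real n * (3 * t\<^sup>2)) * (K * (exp (real n * (3 * t\<^sup>2)) * norm x))"
      using \<open>0 < K\<close> exp_bound[of "3 * t\<^sup>2"] by (intro mult_mono mult_left_mono mult_right_mono) simp_all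
    also have "\<dots> = K * exp (6 * (R * K)\<^sup>2 / real n) * norm x"
    proof -
      have "exp (real n * (3 * t\<^sup>2)) * exp (real n * (3 * t\<^sup>2)) = exp (6 * (real n * t\<^sup>2))"
        by (simp flip: exp_add)
      then show ?thesis
        by (simp add: t2)
    qed
    finally have first: "norm (app ((p * p') ^ n * X * (q' * q) ^ n) x) \<le> \<dots>" .

    \<comment> \<open>Crude bounds on the outer factors suffice: \<open>n t = R K\<close> is fixed,
      while \<open>(1 + t\<^sup>2) ^ n - 1\<close> tends to 0.\<close>
    have "norm (app (p ^ n * X * ((1 - W) ^ n - 1) * q' ^ n) x)
        \<le> (1 + t) ^ n * (K * (((1 + t\<^sup>2) ^ n - 1) * ((1 + t) ^ n * norm x)))"
    proof -
      define v where "v = app (q' ^ n) x"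
      define u where "u = app ((1 - W) ^ n) v - v"
      have "1 \<le> (1 + t\<^sup>2) ^ n"
        by (simp add: one_le_power)
      then have "norm u \<le> ((1 + t\<^sup>2) ^ n - 1) * ((1 + t) ^ n * norm x)"
        unfolding u_def v_def by (intro order_trans[OF W mult_left_mono[OF qn]]) simp_all
      then have "norm (app X u) \<le> K * (((1 + t\<^sup>2) ^ n - 1) * ((1 + t) ^ n * norm x))"
        using \<open>0 < K\<close> by (intro order_trans[OF K(5) mult_left_mono]) simp_all
      from order_trans[OF pn mult_left_mono[OF this]] show ?thesis
        using t(1) by (simp add: u_def v_def)
    qed
    also have "\<dots> \<le> exp (real n * t) * (K * ((exp (real n * t\<^sup>2) - 1) * (exp (real n * t) * norm x)))"
      using \<open>0 < K\<close> exp_bound[of t] exp_bound[of "t\<^sup>2"] t(1) one_le_power[of "1 + t\<^sup>2" n]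
      by (intro mult_mono mult_left_mono mult_right_mono mult_nonneg_nonneg) simp_all
    also have "\<dots> = K * exp (2 * R * K) * (exp ((R * K)\<^sup>2 / real n) - 1) * norm x"
    proof -
      have "exp (R * K) * exp (R * K) = exp (2 * R * K)"
        by (simp flip: exp_add)
      then show ?thesis
        by (simp add: t t2)
    qed
    finally show ?thesis
      unfolding \<mu>_def[symmetric] p_def[symmetric] q'_def[symmetric] split
      using first norm_triangle_ineq4 [of "app ((p * p') ^ n * X * (q' * q) ^ n) x"
          "app (p ^ n * X * ((1 - W) ^ n - 1) * q' ^ n) x"]
      by (simp add: distrib_right del: app_simps(6))
  qed
  have coeff: "norm (app (adj A * X - X * adj B) x)
      \<le> ((K * exp (6 * (R * K)\<^sup>2 / real n) + K * exp (2 * R * K) * (exp ((R * K)\<^sup>2 / real n) - 1)) * norm x) / R"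
    if "0 < n" "0 < R" for R x and n :: nat
  proof (rule weakly_entire_Cauchy_bound)
    let ?n = "of_nat n :: complex"
    \<comment> \<open>The coefficient \<open>- 1 / n\<close> makes the \<open>n\<close> factors
      contribute \<open>- adj B\<close> in total at first order.\<close>
    define g where "g l = app ((1 + cscal (l * (- 1 / ?n)) * adj B) ^ n) x" for l
    have "weakly_entire g x (0 + scaleC (?n * (- 1 / ?n)) (app (adj B) x))"
      unfolding g_def[abs_def] by (intro weakly_entire_power weakly_entire_const)
    then have "weakly_entire g x (- app (adj B) x)"
      using that(1) by (simp add: scaleC_minus1)
    from weakly_entire_power[OF weakly_entire_app[OF this, of X], of "1 / ?n" "adj A" n]
    show "weakly_entire (\<lambda>l. app ((1 + cscal (l * (1 / ?n)) * adj A) ^ n) (app X (g l))) (app X x)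
        (app (adj A * X - X * adj B) x)"
      using that(1) by (simp add: app_minus scaleC_one)
    fix l assume "cmod l = R"
    from bound[OF this that, of x]
    show "norm (app ((1 + cscal (l * (1 / ?n)) * adj A) ^ n) (app X (g l))) \<le>
        (K * exp (6 * (R * K)\<^sup>2 / real n) + K * exp (2 * R * K) * (exp ((R * K)\<^sup>2 / real n) - 1)) * norm x"
      by (simp add: g_def cscal_minus)
  qed fact
  \<comment> \<open>For fixed \<open>R\<close>, letting \<open>n\<close> grow leaves only the
    constant \<open>K\<close>.\<close>
  have limit: "norm (app (adj A * X - X * adj B) x) \<le> K * norm x / R" if "0 < R" for R x
  proof -
    have inv: "(\<lambda>n. c / real n) \<longlonglongrightarrow> 0" for c
      by (rule lim_const_over_n)
    have "(\<lambda>n. ((K * exp (6 * (R * K)\<^sup>2 / real n)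
          + K * exp (2 * R * K) * (exp ((R * K)\<^sup>2 / real n) - 1)) * norm x) / R)
        \<longlonglongrightarrow> ((K * exp 0 + K * exp (2 * R * K) * (exp 0 - 1)) * norm x) / R"
      using that by (intro tendsto_intros inv) simp
    then show ?thesis
      using coeff[OF _ that, of _ x] by (intro LIMSEQ_le_const) (auto intro!: exI[of _ 1])
  qed
  \<comment> \<open>As in Liouville's theorem, letting \<open>R\<close> grow kills the linear
    coefficient.\<close>
  have "app (adj A * X - X * adj B) x = 0" for x
  proof -
    have "(\<lambda>n. K * norm x / real (Suc n)) \<longlonglongrightarrow> 0"
      using LIMSEQ_Suc[OF lim_const_over_n[of "K * norm x"]] by simp
    then have "norm (app (adj A * X - X * adj B) x) \<le> 0"
      using limit[of "real (Suc _)" x] by (intro LIMSEQ_le_const) auto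
    then show ?thesis by simp
  qed
  then show ?thesis
    by (intro bop_eqI) simp
qed

section \<open>Normal operators similar to their negatives\<close>

lemma anticommute_square:
  fixes a b :: "'a::ring"
  assumes "a * b = - (b * a)"
  shows "a * (b * b) = b * b * a"
proof -
  have "a * (b * b) = a * b * b"
    by (simp only: mult.assoc)
  also have "\<dots> = - (b * (a * b))"
    by (subst assms) (simp add: mult.assoc)
  also have "\<dots> = b * b * a"
    unfolding assms by (simp add: mult.assoc)
  finally show ?thesis .
qed

definition unitary :: "'a::chilbert_space bop \<Rightarrow> bool" where
  "unitary U \<longleftrightarrow> adj U * U = 1 \<and> U * adj U = 1"

text \<open>Fuglede--Putnam for the pair \<open>T\<close>, \<open>- T\<close> lets the polar factor
  of \<open>X\<close> inherit the relation; trivial kernels on both sides make this partial isometry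
  unitary.\<close>

lemma anticommuting_unitary:
  assumes T: "adj T * T = T * adj T" and TX: "T * X = - (X * T)"
    and inj: "\<And>x. app X x = 0 \<Longrightarrow> x = 0" "\<And>x. app (adj X) x = 0 \<Longrightarrow> x = 0"
  shows "\<exists>U. unitary U \<and> T * U = - (U * T)"
proof -
  obtain U where "polar_part X U"
    using polar_part_exists by blast
  then have U: "U * adj U * U = U" "\<And>x. app U x = 0 \<longleftrightarrow> app X x = 0"
    "\<And>x. app (adj U) x = 0 \<longleftrightarrow> app (adj X) x = 0"
    "\<And>B C. B * X = X * C \<Longrightarrow> adj B * X = X * adj C \<Longrightarrow> B * U = U * C"
    unfolding polar_part_def by blast+
  have "adj T * X = X * adj (- T)"
    by (rule fuglede_putnam) (simp_all add: T TX)
  then have "T * U = - (U * T)"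
    using U(4)[of T "- T"] TX by simp
  have "app (adj U) (app U x) = x" for x
  proof -
    have "app U (app (adj U) (app U x) - x) = 0"
      using arg_cong[OF U(1), of "\<lambda>S. app S x"] by (simp add: app_diff)
    then show ?thesis
      using inj(1) U(2) by fastforce
  qed
  moreover have "app U (app (adj U) x) = x" for x
  proof -
    have "adj U * U * adj U = adj U"
      using arg_cong[OF U(1), of adj] by (simp add: mult.assoc)
    from arg_cong[OF this, of "\<lambda>S. app S x"] have "app (adj U) (app U (app (adj U) x) - x) = 0"
      by (simp add: app_diff)
    then show ?thesis
      using inj(2) U(3) by fastforce
  qed
  ultimately have "unitary U"
    by (simp add: unitary_def bop_eqI)
  with \<open>T * U = - (U * T)\<close> show ?thesis by blast
qed

text \<open>The polar factor of a self-adjoint operator is its sign. Anticommutation is the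
  intertwining relation between \<open>B\<close> and \<open>- B\<close>.\<close>

lemma sign_exists:
  assumes A: "adj A = A"
  shows "\<exists>J. J * J * J = J \<and> A * J * J = A \<and> (\<forall>B. B * A = A * B \<longrightarrow> B * J = J * B)
    \<and> (\<forall>B. B * A = - (A * B) \<longrightarrow> B * J = - (J * B))"
proof -
  obtain J where "polar_part A J"
    using polar_part_exists by blast
  then have J: "J * J * J = J" "\<And>x. app J x = 0 \<longleftrightarrow> app A x = 0"
    "\<And>B C. B * A = A * C \<Longrightarrow> adj B * A = A * adj C \<Longrightarrow> B * J = J * C"
    using A unfolding polar_part_def by auto
  have "A * J * J = A"
  proof (rule bop_eqI)
    fix x
    have "app J (app J (app J x) - x) = 0"
      using arg_cong[OF J(1), of "\<lambda>S. app S x"] by (simp add: app_diff)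
    then have "app A (app J (app J x) - x) = 0"
      by (simp only: J(2))
    then show "app (A * J * J) x = app A x"
      by (simp add: app_diff)
  qed
  moreover have "B * J = J * B" if "B * A = A * B" for B
    using J(3)[OF that] arg_cong[OF that, of adj] by (simp add: A)
  moreover have "B * J = - (J * B)" if "B * A = - (A * B)" for B
  proof -
    have "A * adj B = - (adj B * A)"
      using arg_cong[OF that, of adj] by (simp add: A)
    then show ?thesis
      using J(3)[of B "- B"] that by simp
  qed
  ultimately show ?thesis
    using J(1) by blast
qed

text \<open>The sign is \<open>+1\<close> on the spectral subspace of the half plane \<open>Re z > 0\<close> together with the
  open half axis \<open>Re z = 0\<close>, \<open>Im z < 0\<close>, and \<open>-1\<close> on the subspace of its mirror image.\<close>

lemma normal_sign_exists:
  assumes T: "adj T * T = T * adj T" and U: "unitary U" and TU: "T * U = - (U * T)"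
  shows "\<exists>G. G * G * G = G \<and> T * (G * G) = T \<and> T * G = G * T \<and> U * G = - (G * U)"
proof -
  \<comment> \<open>Twice the real part of \<open>T\<close>; \<open>C\<close> is minus twice the
    imaginary part.\<close>
  define A where "A = T + adj T"
  define C where "C = cscal \<i> * (T - adj T)"
  have "adj A = A" "adj C = C"
    by (simp_all add: A_def C_def cscal_commute cscal_minus algebra_simps)
  obtain J where J: "J * J * J = J" "A * J * J = A" "\<And>B. B * A = A * B \<Longrightarrow> B * J = J * B"
    "\<And>B. B * A = - (A * B) \<Longrightarrow> B * J = - (J * B)"
    using sign_exists[OF \<open>adj A = A\<close>] by blast
  obtain L where L: "L * L * L = L" "C * L * L = C" "\<And>B. B * C = C * B \<Longrightarrow> B * L = L * B"
    "\<And>B. B * C = - (C * B) \<Longrightarrow> B * L = - (L * B)"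
    using sign_exists[OF \<open>adj C = C\<close>] by blast
  \<comment> \<open>Here unitarity suffices: conjugating the adjoint of \<open>TU\<close> by
    \<open>U\<close> replaces \<open>adj U\<close> by \<open>U\<close>.\<close>
  have UT': "U * adj T = - (adj T * U)"
  proof -
    have "adj U * adj T = - (adj T * adj U)"
      using arg_cong[OF TU, of adj] by simp
    then have "U * (adj U * adj T) * U = - (U * (adj T * adj U) * U)"
      by simp
    moreover have "U * (adj U * adj T) * U = (U * adj U) * adj T * U"
      "U * (adj T * adj U) * U = U * adj T * (adj U * U)"
      by (simp_all add: mult.assoc)
    ultimately show ?thesis
      using U by (simp add: unitary_def)
  qed
  have UT: "U * T = - (T * U)"
    using TU by simp
  have comm: "B * C = C * B" if "B * T = T * B" "B * adj T = adj T * B" for B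
  proof -
    have "B * C = cscal \<i> * (B * (T - adj T))"
      unfolding C_def by (metis cscal_commute mult.assoc)
    then show ?thesis
      using that by (simp add: C_def ring_distribs mult.assoc)
  qed
  have "U * C = cscal \<i> * (U * (T - adj T))"
    unfolding C_def by (metis cscal_commute mult.assoc)
  then have "U * C = - (C * U)"
    using UT UT' by (simp add: C_def ring_distribs mult.assoc)
  then have UL: "U * L = - (L * U)"
    by (rule L)
  have "U * A = - (A * U)"
    using UT UT' by (simp add: A_def ring_distribs)
  then have UJ: "U * J = - (J * U)"
    by (rule J)
  have TJ: "T * J = J * T"
    by (rule J) (simp add: A_def ring_distribs T)
  have TL: "T * L = L * T"
    by (rule L) (simp add: comm T)
  have "A * C = C * A"
    by (rule comm) (simp_all add: A_def ring_distribs T)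
  then have CJ: "C * J = J * C"
    by (intro J) simp
  then have JL: "J * L = L * J"
    by (intro L) simp

  \<comment> \<open>The projection onto the kernel of \<open>A\<close>.\<close>
  define Q where "Q = 1 - J * J"
  have JQ: "J * Q = 0" "Q * J = 0"
    using J(1) by (simp_all add: Q_def ring_distribs mult.assoc)
  have QQ: "Q * Q = Q"
    using JQ(1) by (simp add: Q_def left_diff_distrib mult.assoc)
  have JJ_comm: "J * J * B = B * (J * J)" if "J * B = B * J" for B
    using that by (metis mult.assoc)
  have QL: "Q * L = L * Q" and QC: "Q * C = C * Q" and QT: "Q * T = T * Q"
    using JJ_comm[of L] JJ_comm[of C] JJ_comm[of T] JL CJ TJ by (simp_all add: Q_def ring_distribs)
  have "U * (J * J) = J * J * U"
    by (rule anticommute_square[OF UJ])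
  then have UQ: "U * Q = Q * U"
    by (simp add: Q_def ring_distribs)

  \<comment> \<open>The sign of \<open>A\<close>, completed on the kernel of \<open>A\<close> by the
    sign of \<open>C\<close>. As \<open>U\<close> commutes with \<open>Q\<close>, both summands
    anticommute with \<open>U\<close>.\<close>
  define G where "G = J + Q * L"
  have GG: "G * G = J * J + Q * (L * L)"
  proof -
    have "G * G = J * J + J * Q * L + Q * (L * J) + Q * (L * Q) * L"
      by (simp add: G_def ring_distribs mult.assoc)
    also have "Q * (L * J) = Q * J * L"
      by (simp add: mult.assoc flip: JL)
    also have "Q * (L * Q) * L = Q * Q * (L * L)"
      by (simp add: mult.assoc flip: QL)
    finally show ?thesis
      by (simp add: JQ QQ)
  qed
  have "G * G * G = J * J * J + J * (J * Q) * L + Q * (L * L * J) + Q * (L * L * Q) * L"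
    unfolding GG by (simp add: G_def ring_distribs mult.assoc)
  also have "Q * (L * L * J) = Q * J * (L * L)"
    by (metis JL mult.assoc)
  also have "Q * (L * L * Q) * L = Q * Q * (L * L * L)"
    by (metis QL mult.assoc)
  finally have "G * G * G = G"
    by (simp add: JQ QQ J(1) L(1) G_def)
  moreover have "T * (G * G) = T"
  proof -
    \<comment> \<open>The projection onto the common kernel of \<open>A\<close> and
      \<open>C\<close>, on which \<open>T\<close> vanishes.\<close>
    define Z where "Z = Q * (1 - L * L)"
    have "A * Q = 0"
      using J(2) by (simp add: Q_def right_diff_distrib mult.assoc)
    then have "A * Z = 0"
      by (simp add: Z_def flip: mult.assoc)
    have "C * Z = Q * (C * (1 - L * L))"
      by (simp add: Z_def QC flip: mult.assoc)
    then have "C * Z = 0"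
      using L(2) by (simp add: right_diff_distrib mult.assoc)
    have "cscal \<i> * C = - (T - adj T)"
      using cscal_of_real[of "-1", where ?'a = 'a]
      by (simp add: C_def cscal_mult flip: mult.assoc)
    then have "2 *\<^sub>R T = A - cscal \<i> * C"
      by (simp add: A_def scaleR_2)
    then have "2 *\<^sub>R (T * Z) = A * Z - cscal \<i> * (C * Z)"
      by (metis left_diff_distrib mult.assoc mult_scaleR_left)
    then have "T * Z = 0"
      using \<open>A * Z = 0\<close> \<open>C * Z = 0\<close> by simp
    moreover have "G * G = 1 - Z"
      unfolding GG by (simp add: Z_def Q_def algebra_simps)
    ultimately show ?thesis
      by (simp add: right_diff_distrib)
  qed
  moreover have "T * G = G * T"
  proof -
    have "T * (Q * L) = Q * L * T"
      by (metis QT TL mult.assoc)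
    then show ?thesis
      using TJ by (simp add: G_def ring_distribs)
  qed
  moreover have "U * G = - (G * U)"
  proof -
    have "U * (Q * L) = Q * (U * L)"
      by (metis UQ mult.assoc)
    then show ?thesis
      using UJ UL by (simp add: G_def ring_distribs mult.assoc)
  qed
  ultimately show ?thesis by blast
qed

text \<open>\<open>U\<close> exchanges the two spectral halves \<open>E\<close> and
  \<open>F\<close>, so that \<open>M N = T E\<close> and \<open>N M = - T F\<close>; the difference
  is \<open>T (E + F) = T\<close>.\<close>

lemma square_zero_commutator_if_unitary:
  assumes T: "adj T * T = T * adj T" and U: "unitary U" and TU: "T * U = - (U * T)"
  shows "\<exists>M N. M * M = 0 \<and> N * N = 0 \<and> T = M * N - N * M"
proof -
  obtain G where G: "G * G * G = G" "T * (G * G) = T" "T * G = G * T" "U * G = - (G * U)"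
    using normal_sign_exists[OF assms] by blast
  define V where "V = adj U"
  have VU: "V * U = 1" "U * V = 1"
    using U by (simp_all add: V_def unitary_def)
  \<comment> \<open>The spectral projections of \<open>G\<close> for the eigenvalues 1 and
    -1.\<close>
  define E F where "E = (1/2) *\<^sub>R (G * G + G)" and "F = (1/2) *\<^sub>R (G * G - G)"
  have G4: "G * (G * G) = G" "G * (G * (G * G)) = G * G"
    using G(1) by (simp_all add: mult.assoc)
  have "(G * G + G) * (G * G - G) = 0" "(G * G - G) * (G * G + G) = 0"
    by (simp_all add: ring_distribs mult.assoc G4)
  then have EF: "E * F = 0" "F * E = 0"
    by (simp_all add: E_def F_def)
  have "E + F = (1/2) *\<^sub>R (2 *\<^sub>R (G * G))"
    by (simp add: E_def F_def scaleR_2 flip: scaleR_add_right)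
  then have E_plus_F: "E + F = G * G"
    by simp
  have "(G * G + G) * (G * G + G) = 2 *\<^sub>R (G * G + G)"
    by (simp add: ring_distribs mult.assoc G4 scaleR_2)
  then have EE: "E * E = E"
    by (simp add: E_def)
  have "T * (G * G) = G * G * T" "U * (G * G) = G * G * U"
    using G(3) anticommute_square[OF G(4)] by (metis mult.assoc)+
  then have TE: "T * E = E * T" and UE: "U * E = F * U" and UF: "U * F = E * U"
    using G(3,4) by (simp_all add: E_def F_def ring_distribs)
  have VE: "V * E = F * V" and VF: "V * F = E * V" and VT: "V * T = - (T * V)"
  proof -
    have conj: "V * a = b * V" if "U * b = a * U" for a b
      using arg_cong[OF that, of "\<lambda>x. V * x * V"] VU by (metis mult.assoc mult_1_left mult_1_right)
    show "V * E = F * V" "V * F = E * V"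
      using UE UF by (auto intro!: conj)
    show "V * T = - (T * V)"
      using conj[of "- T" T] TU by simp
  qed
  define M N where "M = T * E * V" and "N = U * E"
  \<comment> \<open>\<open>U\<close> carries the range of \<open>E\<close> into that of
    \<open>F\<close>, which \<open>E\<close> annihilates.\<close>
  have "N * N = U * (E * U) * E"
    by (simp add: N_def mult.assoc)
  then have NN: "N * N = 0"
    by (simp add: mult.assoc EF flip: UF)
  have "M * M = T * E * (V * T) * E * V"
    by (simp add: M_def mult.assoc)
  also have "\<dots> = - (T * (E * T) * (V * E) * V)"
    by (simp add: VT mult.assoc)
  also have "\<dots> = - (T * T * (E * F) * V * V)"
    by (simp add: VE mult.assoc flip: TE)
  finally have MM: "M * M = 0"
    by (simp add: EF)
  have "M * N = T * E * (V * U) * E"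
    by (simp add: M_def N_def mult.assoc)
  then have MN: "M * N = T * E"
    by (simp add: VU EE mult.assoc)
  have "N * M = U * (E * T) * E * V"
    by (simp add: M_def N_def mult.assoc)
  also have "\<dots> = U * T * (E * E) * V"
    by (simp add: mult.assoc flip: TE)
  also have "\<dots> = - (T * (U * E) * V)"
    using TU by (simp add: EE flip: mult.assoc)
  also have "\<dots> = - (T * F * (U * V))"
    by (simp add: UE mult.assoc)
  finally have NM: "N * M = - (T * F)"
    by (simp add: VU)
  have "M * N - N * M = T * (E + F)"
    by (simp add: MN NM distrib_left)
  then have "T = M * N - N * M"
    using E_plus_F G(2) by simp
  with MM NN show ?thesis by blast
qed

text \<open>Normality gives \<open>T x\<close> and \<open>adj T x\<close> equal norms.\<close>

lemma normal_kernel_adj: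
  assumes T: "adj T * T = T * adj T"
  shows "app (adj T) x = 0 \<longleftrightarrow> app T x = 0"
proof -
  have "(norm (app T x))\<^sup>2 = Re (cinner x (app (adj T * T) x))"
    by (simp add: norm_sq_cinner cinner_adj_right)
  also have "\<dots> = Re (cinner x (app (T * adj T) x))"
    using T by simp
  also have "\<dots> = (norm (app (adj T) x))\<^sup>2"
    by (simp add: norm_sq_cinner cinner_adj_left)
  finally show ?thesis
    by (metis norm_eq_zero power2_eq_iff_nonneg norm_ge_zero)
qed

text \<open>\<open>T x\<close> lies in the kernel of \<open>T\<close>, hence in that of
  \<open>adj T\<close>, which is orthogonal to the range of \<open>T\<close>.\<close>

lemma normal_kernel_square:
  assumes T: "adj T * T = T * adj T" and "app T (app T x) = 0"
  shows "app T x = 0"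
proof -
  have "app (adj T) (app T x) = 0"
    using assms normal_kernel_adj by blast
  then have "cinner x (app (adj T) (app T x)) = 0"
    by simp
  then show ?thesis
    by (simp add: cinner_adj_right cinner_eq_zero_iff)
qed

text \<open>Only the part of \<open>M + N\<close> on \<open>(ker T)\<^sup>\<bottom>\<close> matters; on \<open>ker T\<close> it is replaced by the identity.\<close>

lemma unitary_if_square_zero_commutator:
  assumes T: "adj T * T = T * adj T" and M: "M * M = 0" and N: "N * N = 0"
    and MN: "T = M * N - N * M"
  shows "\<exists>U. unitary U \<and> T * U = - (U * T)"
proof -
  define Z where "Z = M + N"
  have MM: "M * (M * a) = 0" and NN: "N * (N * a) = 0" for a
    using M N by (simp_all flip: mult.assoc)
  have TZ: "T * Z = - (Z * T)"
    by (simp add: MN Z_def ring_distribs mult.assoc M N MM NN)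
  \<comment> \<open>\<open>Z^2 = M N + N M\<close>, and the mixed products vanish in its square just
    as in that of \<open>T = M N - N M\<close>.\<close>
  have TT: "Z * Z * Z * Z = T * T"
    by (simp add: MN Z_def ring_distribs mult.assoc M N MM NN)
  obtain J where "polar_part T J"
    using polar_part_exists by blast
  then have J: "J * adj J * J = J" "\<And>x. app J x = 0 \<longleftrightarrow> app T x = 0"
    unfolding polar_part_def by blast+
  \<comment> \<open>The polar part of \<open>T\<close> serves only to build the projection onto its
    kernel.\<close>
  define P where "P = 1 - adj J * J"
  have "adj P = P"
    by (simp add: P_def)
  have "J * P = 0"
    using J(1) by (simp add: P_def right_diff_distrib mult.assoc)
  then have "app J (app P x) = 0" for x
    by (metis app_simps(1,6))
  then have TP: "T * P = 0" and T'P: "adj T * P = 0"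
    using normal_kernel_adj[OF T] J(2) by (auto intro!: bop_eqI)
  have PT: "P * T = 0"
    using arg_cong[OF T'P, of adj] \<open>adj P = P\<close> by simp
  have P_id: "P * a = a" if "T * a = 0" for a
  proof -
    have "app J (app a x) = 0" for x
      using J(2) that by (metis app_simps(1,6))
    then have "J * a = 0"
      by (intro bop_eqI) simp
    then show ?thesis
      by (simp add: P_def left_diff_distrib mult.assoc)
  qed
  have P_fix: "app P x = x" if "app T x = 0" for x
    using that J(2)[of x] by (simp add: P_def)
  have PZP: "P * (Z * P) = Z * P"
  proof (rule P_id)
    have "T * (Z * P) = - (Z * (T * P))"
      using TZ by (simp flip: mult.assoc)
    then show "T * (Z * P) = 0"
      by (simp add: TP)
  qed
  have T'Z': "adj T * adj Z = - (adj Z * adj T)"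
    using arg_cong[OF TZ, of adj] by (metis adj_simps(3,6) minus_minus)
  \<comment> \<open>The kernels of \<open>T\<close> and \<open>adj T\<close> coincide, so the kernel
    of \<open>T\<close> is invariant under \<open>adj Z\<close> as well as \<open>Z\<close>, and
    \<open>P\<close> commutes with \<open>Z\<close>.\<close>
  have "P * (adj Z * P) = adj Z * P"
  proof (rule P_id)
    have "adj T * (adj Z * P) = - (adj Z * (adj T * P))"
      using T'Z' by (simp flip: mult.assoc)
    then have "adj T * (adj Z * P) = 0"
      by (simp add: T'P)
    then have "app (adj T) (app (adj Z * P) x) = 0" for x
      by (metis app_simps(1,6))
    then have "app T (app (adj Z * P) x) = 0" for x
      using normal_kernel_adj[OF T] by blast
    then show "T * (adj Z * P) = 0"
      by (intro bop_eqI) simp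
  qed
  from arg_cong[OF this, of adj] have "P * Z * P = P * Z"
    by (simp add: \<open>adj P = P\<close>)
  with PZP have ZP: "Z * P = P * Z"
    by (simp add: mult.assoc)
  have PP: "P * P = P"
    using TP by (rule P_id)
  define X where "X = Z - Z * P + P"
  have TX: "T * X = - (X * T)"
  proof -
    have "T * (Z * P) = 0"
      using TP TZ by (metis PZP TP mult.assoc mult_zero_left)
    then show ?thesis
      by (simp add: X_def ring_distribs mult.assoc TZ TP PT)
  qed
  have PX: "P * X = P"
  proof -
    have "P * X = P * Z - P * (Z * P) + P * P"
      by (simp add: X_def distrib_left right_diff_distrib)
    then show ?thesis
      unfolding PZP unfolding ZP PP by simp
  qed
  have PX': "P * adj X = P"
  proof -
    have "P * adj X = P * adj Z - P * P * adj Z + P * P"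
      by (simp add: X_def distrib_left right_diff_distrib \<open>adj P = P\<close> mult.assoc)
    then show ?thesis
      by (simp add: PP)
  qed
  \<comment> \<open>Applying \<open>P\<close> gives \<open>P x = 0\<close>, so
    \<open>Z x = 0\<close>; then \<open>T^2 x = Z^4 x = 0\<close> puts \<open>x\<close> in the
    kernel of \<open>T\<close>, where \<open>P x = x\<close>.\<close>
  have "x = 0" if "app X x = 0" for x
  proof -
    have "app P x = 0"
      using that PX by (metis app_simps(6) app_zero)
    then have "app Z x = 0"
      using that by (simp add: X_def)
    then have "app T (app T x) = 0"
      using arg_cong[OF TT, of "\<lambda>S. app S x"] by simp
    then have "app T x = 0"
      by (rule normal_kernel_square[OF T])
    then show ?thesis
      using P_fix \<open>app P x = 0\<close> by metis
  qed
  moreover have "x = 0" if "app (adj X) x = 0" for x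
  proof -
    have "app P x = 0"
      using that PX' by (metis app_simps(6) app_zero)
    moreover have "adj X = adj Z - adj Z * P + P"
      using arg_cong[OF ZP, of adj] by (simp add: X_def \<open>adj P = P\<close>)
    ultimately have "app (adj Z) x = 0"
      using that by simp
    then have "app (adj T) (app (adj T) x) = 0"
      using arg_cong[OF arg_cong[OF TT, of adj], of "\<lambda>S. app S x"] by simp
    then have "app (adj T) x = 0"
      using normal_kernel_square[of "adj T"] T by simp
    then show ?thesis
      using P_fix \<open>app P x = 0\<close> normal_kernel_adj[OF T] by metis
  qed
  ultimately show ?thesis
    using anticommuting_unitary[OF T TX] by blast
qed

text \<open>Invertibility makes \<open>S\<close> and its adjoint injective, and multiplying by
  \<open>S\<close> turns the similarity into anticommutation.\<close>

lemma unitary_if_similar: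
  assumes T: "adj T * T = T * adj T" and S: "S * R = 1" "R * S = 1" and TS: "- T = R * T * S"
  shows "\<exists>U. unitary U \<and> T * U = - (U * T)"
proof (rule anticommuting_unitary[OF T])
  have "S * (- T) = S * R * (T * S)"
    unfolding TS by (simp add: mult.assoc)
  then show "T * S = - (S * T)"
    by (simp add: S)
  show "x = 0" if "app S x = 0" for x
    using that S(2) by (metis app_simps(2,6) app_zero)
  have "adj R * adj S = 1"
    using arg_cong[OF S(1), of adj] by simp
  then show "x = 0" if "app (adj S) x = 0" for x
    using that by (metis app_simps(2,6) app_zero)
qed

lemma unitary_conj_iff: "unitary U \<Longrightarrow> - T = adj U * T * U \<longleftrightarrow> T * U = - (U * T)"
proof -
  assume "unitary U"
  then have U: "adj U * (U * a) = a" "U * (adj U * a) = a" for a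
    by (simp_all add: unitary_def flip: mult.assoc)
  show ?thesis
  proof
    assume "- T = adj U * T * U"
    then have "U * (- T) = U * (adj U * (T * U))"
      by (simp add: mult.assoc)
    then show "T * U = - (U * T)"
      by (simp add: U)
  next
    assume "T * U = - (U * T)"
    then show "- T = adj U * T * U"
      by (simp add: mult.assoc U)
  qed
qed

section \<open>Transfer from the operator algebra to functions\<close>

lemma app_mult: "app (S * T) = app S \<circ> app T" and app_one: "app 1 = id"
  and app_zero_op: "app 0 = (\<lambda>_. 0)" and app_minus_op: "app (- T) = (\<lambda>x. - app T x)"
  by (simp_all add: fun_eq_iff)

lemma unitary_op_app: "unitary_op (app U) \<longleftrightarrow> unitary U"
  by (simp add: unitary_op_def unitary_def bounded_clinear_op_app flip: adj.rep_eq app_mult app_one)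
    (simp add: app_inject)

lemma bounded_clinear_op_iff: "bounded_clinear_op T \<longleftrightarrow> (\<exists>t. T = app t)"
  by (metis Bop_inverse bounded_clinear_op_app mem_Collect_eq)

theorem theorem2p06:
  fixes T :: "'a::chilbert_space \<Rightarrow> 'a"
  assumes separable: "\<exists>D::'a set. countable D \<and> closure D = UNIV"
    and T_bounded: "bounded_clinear_op T"
    and T_normal: "normal_op T"
  shows "((\<exists>U. unitary_op U \<and> (\<lambda>x. - T x) = cadjoint U \<circ> T \<circ> U)
            \<longleftrightarrow> similar_op T (\<lambda>x. - T x))
       \<and> (similar_op T (\<lambda>x. - T x)
            \<longleftrightarrow> (\<exists>M N. bounded_clinear_op M \<and> bounded_clinear_op N \<and>
                    M \<circ> M = (\<lambda>_. 0) \<and> N \<circ> N = (\<lambda>_. 0) \<and>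
                    T = (\<lambda>x. M (N x) - N (M x))))"
proof -
  obtain t where T: "T = app t"
    using T_bounded bounded_clinear_op_iff by blast
  have normal: "adj t * t = t * adj t"
    using T_normal by (simp add: normal_op_def T app_inject flip: adj.rep_eq app_mult)
  \<comment> \<open>Each of the three conditions is first restated in the operator algebra.\<close>
  have a: "(\<exists>U. unitary_op U \<and> (\<lambda>x. - T x) = cadjoint U \<circ> T \<circ> U)
      \<longleftrightarrow> (\<exists>U. unitary U \<and> - t = adj U * t * U)"
  proof -
    have "(\<lambda>x. - T x) = cadjoint (app U) \<circ> T \<circ> app U \<longleftrightarrow> - t = adj U * t * U" for U
      by (simp add: T app_inject flip: adj.rep_eq app_mult app_minus_op)
    moreover have "\<exists>u. U = app u" if "unitary_op U" for U :: "'a \<Rightarrow> 'a"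
      using that bounded_clinear_op_iff unitary_op_def by blast
    ultimately show ?thesis
      by (metis unitary_op_app)
  qed
  have b: "similar_op T (\<lambda>x. - T x) \<longleftrightarrow> (\<exists>S R. S * R = 1 \<and> R * S = 1 \<and> - t = R * t * S)"
  proof -
    have "app S \<circ> app R = id \<and> app R \<circ> app S = id \<and> (\<lambda>x. - T x) = app R \<circ> T \<circ> app S
        \<longleftrightarrow> S * R = 1 \<and> R * S = 1 \<and> - t = R * t * S" for S R
      by (simp add: T app_inject flip: app_mult app_one app_minus_op)
    then show ?thesis
      unfolding similar_op_def bounded_clinear_op_iff by metis
  qed
  have c: "(\<exists>M N. bounded_clinear_op M \<and> bounded_clinear_op N \<and> M \<circ> M = (\<lambda>_. 0) \<and> N \<circ> N = (\<lambda>_. 0)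
        \<and> T = (\<lambda>x. M (N x) - N (M x)))
      \<longleftrightarrow> (\<exists>M N. M * M = 0 \<and> N * N = 0 \<and> t = M * N - N * M)"
  proof -
    have "(\<lambda>x. app M (app N x) - app N (app M x)) = app (M * N - N * M)" for M N :: "'a bop"
      by (simp add: fun_eq_iff)
    then have key: "app M \<circ> app M = (\<lambda>_. 0) \<and> app N \<circ> app N = (\<lambda>_. 0)
          \<and> T = (\<lambda>x. app M (app N x) - app N (app M x))
        \<longleftrightarrow> M * M = 0 \<and> N * N = 0 \<and> t = M * N - N * M" for M N
      by (simp add: T app_inject flip: app_mult app_zero_op)
    show ?thesis (is "?L \<longleftrightarrow> ?R")
    proof
      assume ?L
      then show ?R
        unfolding bounded_clinear_op_iff using key by blast
    next
      assume ?R
      then show ?L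
        using key bounded_clinear_op_app by blast
    qed
  qed
  \<comment> \<open>A unitary is a similarity whose inverse is its adjoint.\<close>
  have 1: "\<exists>S R. S * R = 1 \<and> R * S = 1 \<and> - t = R * t * S" if "\<exists>U. unitary U \<and> - t = adj U * t * U"
    using that unfolding unitary_def by blast
  have 2: "\<exists>U. unitary U \<and> - t = adj U * t * U" if "\<exists>S R. S * R = 1 \<and> R * S = 1 \<and> - t = R * t * S"
    using that unitary_if_similar[OF normal] unitary_conj_iff by blast
  have 3: "\<exists>M N. M * M = 0 \<and> N * N = 0 \<and> t = M * N - N * M" if "\<exists>U. unitary U \<and> - t = adj U * t * U"
    using that square_zero_commutator_if_unitary[OF normal] unitary_conj_iff by blast
  have 4: "\<exists>U. unitary U \<and> - t = adj U * t * U" if "\<exists>M N. M * M = 0 \<and> N * N = 0 \<and> t = M * N - N * M"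
    using that unitary_if_square_zero_commutator[OF normal] unitary_conj_iff by blast
  show ?thesis
    unfolding a b c using 1 2 3 4 by argo
qed

end
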